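(* Let $n\ge 3$ be odd. If $\frac{n+1}{2}$ is odd, then $\mathcal{SD}_n=\{A\in\mathrm{SGL}_n(\mathbb{F}_2): d(A,I_n)=\frac{n+5}{2},\ \widehat d(A,I_n)=\frac{n+1}{2}\}$. If $\frac{n+1}{2}$ is even, then $\mathcal{SD}_n=\{A\in\mathrm{SGL}_n(\mathbb{F}_2): d(A,I_n)=\frac{n+5}{2},\ \widehat d(A,I_n)\in\{\frac{n+1}{2},\frac{n+3}{2}\}\}$.
   Context: $\mathbb{F}_2$ is the binary field; $S_n(\mathbb{F}_2)$ is the set of symmetric $n\times n$ matrices over $\mathbb{F}_2$ and $\mathrm{SGL}_n(\mathbb{F}_2)$ its subset of invertible ones. $\widehat\Gamma_n$ is the graph on $S_n(\mathbb{F}_2)$ with $A\sim B$ iff $\mathrm{rank}(A-B)=1$, with graph distance $\widehat d$; $\Gamma_n$ is its induced subgraph on $\mathrm{SGL}_n(\mathbb{F}_2)$, with graph distance $d$. $\mathcal{SD}_n=\{A\in\mathrm{SGL}_n(\mathbb{F}_2): d(A,I_n)=\frac{n+5}{2},\ \mathrm{rank}(A-I_n)=\frac{n+1}{2}\}$. *)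

theory Defs
  imports "Jordan_Normal_Form.DL_Rank" "HOL-Library.Z2" "HOL-Library.Extended_Nat"
begin

definition rank2 :: "nat \<Rightarrow> bit mat \<Rightarrow> nat" where
  "rank2 n A = vec_space.rank n A"

definition Sym :: "nat \<Rightarrow> bit mat set" where
  "Sym n = {A \<in> carrier_mat n n. transpose_mat A = A}"

definition SGL :: "nat \<Rightarrow> bit mat set" where
  "SGL n = {A \<in> Sym n. invertible_mat A}"

definition radj :: "nat \<Rightarrow> bit mat \<Rightarrow> bit mat \<Rightarrow> bool" where
  "radj n A B \<longleftrightarrow> rank2 n (A - B) = 1"

definition is_walk :: "'a set \<Rightarrow> ('a \<Rightarrow> 'a \<Rightarrow> bool) \<Rightarrow> 'a list \<Rightarrow> bool" where
  "is_walk V E xs \<longleftrightarrow> xs \<noteq> [] \<and> set xs \<subseteq> V \<and> (\<forall>i. Suc i < length xs \<longrightarrow> E (xs ! i) (xs ! Suc i))"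

text \<open>Graph distance (infinite if no walk exists).\<close>
definition gdist :: "'a set \<Rightarrow> ('a \<Rightarrow> 'a \<Rightarrow> bool) \<Rightarrow> 'a \<Rightarrow> 'a \<Rightarrow> enat" where
  "gdist V E a b = (INF xs \<in> {xs. is_walk V E xs \<and> hd xs = a \<and> last xs = b}. enat (length xs - 1))"

definition dhat :: "nat \<Rightarrow> bit mat \<Rightarrow> bit mat \<Rightarrow> enat" where
  "dhat n = gdist (Sym n) (radj n)"

definition dG :: "nat \<Rightarrow> bit mat \<Rightarrow> bit mat \<Rightarrow> enat" where
  "dG n = gdist (SGL n) (radj n)"

definition SD :: "nat \<Rightarrow> bit mat set" where
  "SD n = {A \<in> SGL n. dG n A (1\<^sub>m n) = enat ((n + 5) div 2) \<and> rank2 n (A - 1\<^sub>m n) = (n + 1) div 2}"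

end

theory Submission
  imports Defs
begin

text \<open>
  Write \<open>B = A + I\<close>, \<open>C = A\<^sup>-\<^sup>1 + I\<close>. A symmetric matrix of rank \<open>m\<close> over the binary field is a sum of
  \<open>m\<close> matrices \<open>u u\<^sup>T\<close> unless it is alternating and nonzero, in which case \<open>m\<close> is even and \<open>m + 1\<close>
  summands are needed. So \<open>rank B\<close> determines the distance in the full graph up to the alternating case,
  and with \<open>r = (n + 1) / 2\<close> two configurations must be excluded at distance \<open>r + 2\<close> from \<open>I\<close> in the
  invertible graph: \<open>B\<close> of odd rank \<open>r + 1\<close>, and \<open>B\<close> alternating of rank \<open>r - 1\<close>.

  Both follow from one upper bound. A step \<open>A \<mapsto> A + u u\<^sup>T\<close> with \<open>u = B w\<close> lowers the rank of \<open>B\<close> and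
  stays invertible as soon as \<open>w\<^sup>T B w = w\<^sup>T C w = 1\<close>. It changes \<open>C\<close> by \<open>v v\<^sup>T\<close> with \<open>v = C w\<close>, hence
  \<open>D = A + A\<^sup>-\<^sup>1 = B + C = B C\<close> by \<open>u u\<^sup>T + v v\<^sup>T\<close>. One can descend to \<open>I\<close> in \<open>rank B\<close> steps if \<open>B\<close> and
  \<open>C\<close> stay non-alternating and \<open>D\<close> never has rank one. Each non-alternating condition forbids at most
  one \<open>u\<close>, the condition on \<open>D\<close> at most three, while at least a quarter of the range of \<open>B\<close> is available.
  In the first configuration \<open>D\<close> has rank at least 3 since \<open>rank D = rank (B B)\<close>; in the second
  a single preliminary step \<open>A \<mapsto> A + v v\<^sup>T\<close> with \<open>v\<close> outside the range of \<open>B\<close> makes the bound applicable.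
\<close>

section \<open>Self-adjoint operators over the binary field\<close>

lemma finite_if_card_power2: "card X = 2 ^ m \<Longrightarrow> finite X"
  by (rule card_ge_0_finite) simp

text \<open>Sums and products of bits stay in ring form instead of being rewritten to boolean
  operations.\<close>

declare add_bit_eq_xor [simp del] mult_bit_eq_and [simp del]

lemma bit_add_self [simp]: "a + a = 0" "a + (a + b) = b" for a b :: bit
  by (cases a; cases b; simp)+

lemma bit_add_eq_0_iff: "a + b = 0 \<longleftrightarrow> a = b" for a b :: bit
  by (cases a; cases b) simp_all

lemma bit_mult_self [simp]: "a * a = a" for a :: bit
  by (cases a) simp_all

text \<open>A vector space over the binary field is just an abelian group of exponent two, so no
  scalar multiplication is assumed. The space may be infinite; ranks are expressed as
  \<open>card (range B) = 2 ^ m\<close>.\<close>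

locale binary_form =
  fixes dot :: "'v::ab_group_add \<Rightarrow> 'v \<Rightarrow> bit" (infixl "\<diamondop>" 70)
  assumes add_self [simp]: "x + x = 0"
    and dot_add_left: "(x + y) \<diamondop> z = x \<diamondop> z + y \<diamondop> z"
    and dot_commute: "x \<diamondop> y = y \<diamondop> x"
    and dot_nondegenerate: "(\<And>y. x \<diamondop> y = 0) \<Longrightarrow> x = 0"
begin

lemma add_self_left [simp]: "x + (x + y) = y" for x y :: 'v
  by (simp add: add.assoc [symmetric])

lemma add_eq_zero_iff: "x + y = 0 \<longleftrightarrow> x = y" for x y :: 'v
  by (metis add_self add_eq_0_iff)

lemma add_eq_swap: "x + y = z \<longleftrightarrow> x = y + z" for x y z :: 'v
  by (metis add_self_left add.commute)

lemma dot_add_right: "x \<diamondop> (y + z) = x \<diamondop> y + x \<diamondop> z"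
  by (metis dot_add_left dot_commute)

lemma dot_zero_left [simp]: "0 \<diamondop> x = 0"
  using dot_add_left [of 0 0 x] by simp

lemma dot_zero_right [simp]: "x \<diamondop> 0 = 0"
  by (metis dot_commute dot_zero_left)

lemma dot_eqI: "x = y" if "\<And>z. x \<diamondop> z = y \<diamondop> z"
proof -
  have "x + y = 0"
    by (rule dot_nondegenerate) (simp add: dot_add_left that)
  then show ?thesis by (simp add: add_eq_zero_iff)
qed

definition scale :: "bit \<Rightarrow> 'v \<Rightarrow> 'v"
  where "scale c u = (if c = 1 then u else 0)"

lemma scale_zero_one [simp]: "scale 0 u = 0" "scale 1 u = u" "scale c 0 = 0"
  by (simp_all add: scale_def)

lemma scale_add_left: "scale (c + d) u = scale c u + scale d u"
  by (cases c; cases d) simp_all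

lemma scale_add_right: "scale c (u + v) = scale c u + scale c v"
  by (cases c) simp_all

lemma scale_scale: "scale c (scale d u) = scale (c * d) u"
  by (cases c; cases d) simp_all

lemma dot_scale [simp]: "scale c u \<diamondop> x = c * (u \<diamondop> x)" "x \<diamondop> scale c u = c * (x \<diamondop> u)"
  by (cases c; simp)+

lemmas form_simps = dot_add_left dot_add_right scale_add_left scale_add_right scale_scale algebra_simps

definition selfadj :: "('v \<Rightarrow> 'v) \<Rightarrow> bool"
  where "selfadj B \<longleftrightarrow> (\<forall>x y. B x \<diamondop> y = x \<diamondop> B y)"

definition alternating :: "('v \<Rightarrow> 'v) \<Rightarrow> bool"
  where "alternating B \<longleftrightarrow> (\<forall>x. x \<diamondop> B x = 0)"

text \<open>The operator form of \<open>B + u u\<^sup>T\<close>.\<close>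

definition upd :: "('v \<Rightarrow> 'v) \<Rightarrow> 'v \<Rightarrow> 'v \<Rightarrow> 'v"
  where "upd B u x = B x + scale (u \<diamondop> x) u"

lemma selfadjD: "selfadj B \<Longrightarrow> B x \<diamondop> y = x \<diamondop> B y"
  by (simp add: selfadj_def)

text \<open>Nondegeneracy makes additivity automatic, which is why \<open>selfadj\<close> does not
  mention it.\<close>

lemma selfadj_add:
  assumes "selfadj B" shows "B (x + y) = B x + B y"
  by (rule dot_eqI) (simp add: selfadjD [OF assms] dot_add_left)

lemma selfadj_zero: "selfadj B \<Longrightarrow> B 0 = 0"
  using selfadj_add [of B 0 0] by simp

lemma selfadj_scale: "selfadj B \<Longrightarrow> B (scale c x) = scale c (B x)"
  by (cases c) (simp_all add: selfadj_zero)

lemma selfadj_upd: "selfadj B \<Longrightarrow> selfadj (upd B u)"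
  unfolding selfadj_def upd_def by (simp add: dot_add_left dot_add_right) (metis dot_commute mult.commute)

lemma selfadj_sum: "selfadj B \<Longrightarrow> selfadj C \<Longrightarrow> selfadj (\<lambda>x. B x + C x)"
  unfolding selfadj_def by (simp add: dot_add_left dot_add_right)

lemma upd_upd [simp]: "upd (upd B u) u = B"
  by (rule ext) (simp add: upd_def add.assoc)

text \<open>The cross terms agree by symmetry and cancel in characteristic two, so the quadratic
  form of a self-adjoint operator is linear.\<close>

lemma form_add: "selfadj B \<Longrightarrow> (x + y) \<diamondop> B (x + y) = x \<diamondop> B x + y \<diamondop> B y"
  using selfadjD [of B y x] dot_commute [of "B y" x]
  by (simp add: selfadj_add dot_add_left dot_add_right add_ac)

lemma form_upd: "x \<diamondop> upd B u x = x \<diamondop> B x + u \<diamondop> x"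
  by (cases "u \<diamondop> x") (simp_all add: upd_def form_simps dot_commute [of x u])

lemma alternating_upd_iff: "alternating (upd B u) \<longleftrightarrow> (\<forall>x. x \<diamondop> B x = u \<diamondop> x)"
  unfolding alternating_def form_upd
  by (simp add: bit_add_eq_0_iff)

lemma exists_dot_one: "u \<noteq> 0 \<Longrightarrow> \<exists>x. u \<diamondop> x = 1"
  using dot_nondegenerate [of u] by (metis bit_not_zero_iff)

lemma exists_dual2:
  assumes "u \<noteq> 0" "u \<noteq> v"
  shows "\<exists>x. u \<diamondop> x = 1 \<and> v \<diamondop> x = 0"
proof -
  obtain x where x: "u \<diamondop> x = 1" using exists_dot_one assms by blast
  obtain y where y: "(u + v) \<diamondop> y = 1" using exists_dot_one [of "u + v"] assms
    by (auto simp: add_eq_zero_iff)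
  show ?thesis
    by (rule exI [of _ "if v \<diamondop> x = 0 then x else if u \<diamondop> y = 1 then y else x + y"])
       (use x y in \<open>cases "u \<diamondop> y"; cases "v \<diamondop> y"; auto simp: form_simps\<close>)
qed

text \<open>The hypotheses place \<open>u\<close> outside the span of \<open>v\<close> and
  \<open>f\<close>. Both \<open>x\<close> and \<open>y\<close> are orthogonal to \<open>v\<close>,
  and one of \<open>x\<close>, \<open>y\<close>, \<open>x + y\<close> meets the other two
  conditions.\<close>

lemma exists_dual3:
  assumes "u \<noteq> 0" "u \<noteq> v" "u \<noteq> f" "u \<noteq> v + f"
  shows "\<exists>x. u \<diamondop> x = 1 \<and> v \<diamondop> x = 0 \<and> f \<diamondop> x = 0"
proof -
  obtain x where x: "u \<diamondop> x = 1" "v \<diamondop> x = 0" using exists_dual2 assms by blast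
  have "u + f \<noteq> 0" "u + f \<noteq> v" using assms by (auto simp: add_eq_zero_iff add_eq_swap add.commute)
  then obtain y where y: "(u + f) \<diamondop> y = 1" "v \<diamondop> y = 0" using exists_dual2 by blast
  show ?thesis
    by (rule exI [of _ "if f \<diamondop> x = 0 then x else if u \<diamondop> y = 1 then y else x + y"])
       (use x y in \<open>cases "u \<diamondop> y"; cases "f \<diamondop> y"; auto simp: form_simps\<close>)
qed

section \<open>Ranges under rank one updates\<close>

lemma range_upd_subset: "range (upd B u) \<subseteq> range B \<union> (+) u ` range B"
  unfolding upd_def scale_def by (auto simp: add.commute)

lemma finite_range_upd: "finite (range B) \<Longrightarrow> finite (range (upd B u))"
  by (rule finite_subset [OF range_upd_subset]) simp

lemma card_range_upd_le:
  assumes "finite (range B)"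
  shows "card (range (upd B u)) \<le> 2 * card (range B)"
proof -
  have "card (range (upd B u)) \<le> card (range B \<union> (+) u ` range B)"
    by (rule card_mono [OF _ range_upd_subset]) (simp add: assms)
  also have "\<dots> \<le> card (range B) + card ((+) u ` range B)"
    by (rule card_Un_le)
  also have "\<dots> \<le> 2 * card (range B)"
    using card_image_le [OF assms, of "(+) u"] by simp
  finally show ?thesis .
qed

text \<open>The updated operator annihilates \<open>w\<close>, so its range is orthogonal to
  \<open>w\<close>, while \<open>B w\<close> is not. Hence \<open>range B\<close> splits into the
  new range and its disjoint translate by \<open>B w\<close>.\<close>

lemma card_range_halve:
  assumes B: "selfadj B" and w: "w \<diamondop> B w = 1" and fin: "finite (range B)"
  shows "card (range B) = 2 * card (range (upd B (B w)))"
proof -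
  let ?u = "B w" and ?R = "range (upd B (B w))"
  have sub: "?R \<subseteq> range B"
    unfolding upd_def scale_def by (auto simp: selfadj_add [OF B, symmetric] simp del: selfadj_add)
  have orth: "y \<diamondop> w = 0" if yR: "y \<in> ?R" for y
  proof -
    obtain x where y: "y = upd B ?u x" using yR by blast
    have "y \<diamondop> w = x \<diamondop> ?u + (?u \<diamondop> x) * (w \<diamondop> ?u)"
      by (simp add: y upd_def dot_add_left selfadjD [OF B])
    then show ?thesis by (simp add: w dot_commute [of "B w" x])
  qed
  have eq: "range B = ?R \<union> (+) ?u ` ?R"
  proof
    show "range B \<subseteq> ?R \<union> (+) ?u ` ?R"
    proof
      fix y assume "y \<in> range B"
      then obtain x where x: "y = B x" by blast
      have "y = upd B ?u x + scale (?u \<diamondop> x) ?u" by (simp add: upd_def x add.assoc)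
      then show "y \<in> ?R \<union> (+) ?u ` ?R" by (auto simp: scale_def add.commute split: if_splits)
    qed
    show "?R \<union> (+) ?u ` ?R \<subseteq> range B"
      using sub by (auto simp: upd_def scale_def simp flip: selfadj_add [OF B])
  qed
  have "?u + y \<notin> ?R" if "y \<in> ?R" for y
    using orth [of "?u + y"] orth [OF that] w by (auto simp: dot_add_left dot_commute [of "B w" w])
  then have "?R \<inter> (+) ?u ` ?R = {}" by (metis (no_types, lifting) disjoint_iff imageE)
  moreover have "finite ?R" using fin sub finite_subset by blast
  ultimately have "card (?R \<union> (+) ?u ` ?R) = card ?R + card ((+) ?u ` ?R)"
    by (intro card_Un_disjoint) simp_all
  then have "card (range B) = card ?R + card ((+) ?u ` ?R)"
    by (simp only: eq [symmetric])
  then show ?thesis by (simp add: card_image)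
qed

text \<open>The update is \<open>B\<close> after a transvection, and the transvection is an
  involution because \<open>w\<close> is orthogonal to \<open>B w\<close>.\<close>

lemma range_upd_alternating:
  assumes B: "selfadj B" and alt: "alternating B"
  shows "range (upd B (B w)) = range B"
proof -
  let ?T = "\<lambda>x. x + scale (B w \<diamondop> x) w"
  have eq: "upd B (B w) = B \<circ> ?T"
    by (rule ext) (simp add: upd_def selfadj_add [OF B] selfadj_scale [OF B])
  have "?T (?T x) = x" for x
    using alt unfolding alternating_def
    by (simp add: form_simps dot_commute [of "B w" w])
  then have "surj ?T" by (rule surjI)
  then show ?thesis unfolding eq by (metis fun.set_map image_comp)
qed

text \<open>Induction by splitting off a hyperbolic pair, which lowers the rank by two.\<close>

lemma even_rank_alternating:
  assumes "selfadj B" "alternating B" "card (range B) = 2 ^ m"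
  shows "even m"
  using assms
proof (induction m arbitrary: B rule: less_induct)
  case (less m)
  note B = less.prems(1)
  have fin: "finite (range B)" using finite_if_card_power2 [OF less.prems(3)] .
  show ?case
  proof (cases "\<forall>x. B x = 0")
    case True
    then have "range B = {0}" by auto
    then have "(2::nat) ^ m = 1" using less.prems(3) by simp
    then show ?thesis by simp
  next
    case False
    then obtain y where "B y \<noteq> 0" by blast
    then obtain x where xy: "B y \<diamondop> x = 1" using exists_dot_one by blast
    define u where "u = B x"
    define v where "v = B y"
    have uy: "u \<diamondop> y = 1" and vx: "v \<diamondop> x = 1"
      using xy selfadjD [OF B, of x y] by (simp_all add: u_def v_def dot_commute [of x])
    have ux: "u \<diamondop> x = 0" and vy: "v \<diamondop> y = 0"
      using less.prems(2) selfadjD [OF B, of x x] selfadjD [OF B, of y y]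
      by (simp_all add: alternating_def u_def v_def)
    \<comment> \<open>The three updates add up to \<open>u v\<^sup>T + v u\<^sup>T\<close>, which is
      alternating. The first keeps the range, each of the other two halves it.\<close>
    define B1 where "B1 = upd B u"
    define B2 where "B2 = upd B1 (u + v)"
    define B3 where "B3 = upd B2 v"
    have sa: "selfadj B1" "selfadj B2" "selfadj B3"
      by (simp_all add: B1_def B2_def B3_def selfadj_upd B)
    have r1: "range B1 = range B"
      unfolding B1_def u_def by (rule range_upd_alternating [OF B less.prems(2)])
    have B1y: "B1 y = u + v" by (simp add: B1_def upd_def uy v_def add.commute)
    have r2: "card (range B1) = 2 * card (range B2)"
      using card_range_halve [OF sa(1), of y] fin r1
      by (simp add: B1y B2_def dot_commute [of y "u + v"] dot_add_left uy vy)
    have B2x: "B2 x = v"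
      by (simp add: B2_def B1_def upd_def ux vx dot_add_left) (simp add: u_def)
    have r3: "card (range B2) = 2 * card (range B3)"
      using card_range_halve [OF sa(2), of x] fin r1
      by (simp add: B2x B3_def dot_commute [of x v] vx) (simp add: B2_def finite_range_upd)
    have alt3: "alternating B3"
      using less.prems(2)
      by (simp add: alternating_def B3_def B2_def B1_def form_upd dot_add_left add_ac)
    have c: "2 ^ m = 4 * card (range B3)" using r1 r2 r3 less.prems(3) by simp
    have "m \<ge> 2"
    proof (rule ccontr)
      assume "\<not> m \<ge> 2"
      then have "m = 0 \<or> m = 1" by linarith
      then have "(2::nat) ^ m = 1 \<or> (2::nat) ^ m = 2" by auto
      then show False using c by presburger
    qed
    then obtain k where k: "m = k + 2" by (metis le_add_diff_inverse2)
    then have "card (range B3) = 2 ^ k" using c by simp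
    then have "even k" using less.IH [of k B3] sa alt3 k by simp
    then show ?thesis using k by simp
  qed
qed

section \<open>Sums of outer products\<close>

text \<open>Keeping each \<open>u\<close> in the current range guarantees that it comes from a
  vector of length \<open>n\<close> once \<open>B\<close> is the operator of a matrix.\<close>

inductive outer_sum :: "nat \<Rightarrow> ('v \<Rightarrow> 'v) \<Rightarrow> bool" where
  outer_sum_0: "outer_sum 0 (\<lambda>_. 0)"
| outer_sum_Suc: "u \<in> range B \<Longrightarrow> u \<noteq> 0 \<Longrightarrow> outer_sum k (upd B u) \<Longrightarrow> outer_sum (Suc k) B"

lemma card_range_1: "selfadj B \<Longrightarrow> card (range B) = 1 \<Longrightarrow> B = (\<lambda>_. 0)"
  by (metis (no_types, lifting) card_1_singletonE ext rangeI selfadj_zero singletonD)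

text \<open>A step with \<open>w \<diamondop> B w = 1\<close> lowers the rank by one. The only
  obstacle is a nonzero alternating remainder, which a single choice of \<open>u\<close> can cause,
  so another choice avoids it.\<close>

lemma outer_sum_nonalternating:
  assumes "selfadj B" "\<not> alternating B" "card (range B) = 2 ^ m"
  shows "outer_sum m B"
  using assms
proof (induction m arbitrary: B)
  case 0
  then have "B = (\<lambda>_. 0)" by (intro card_range_1) simp_all
  then show ?case by (simp only: outer_sum_0)
next
  case (Suc m)
  note B = Suc.prems(1)
  have fin: "finite (range B)" using finite_if_card_power2 [OF Suc.prems(3)] .
  have step: "outer_sum (Suc m) B"
    if w: "w \<diamondop> B w = 1" and ok: "\<not> alternating (upd B (B w)) \<or> upd B (B w) = (\<lambda>_. 0)" for w
  proof -
    have c: "card (range (upd B (B w))) = 2 ^ m"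
      using card_range_halve [OF B w fin] Suc.prems(3) by simp
    have "outer_sum m (upd B (B w))"
    proof (cases "alternating (upd B (B w))")
      case False
      then show ?thesis using Suc.IH [OF selfadj_upd [OF B]] c by blast
    next
      case True
      with ok have z: "upd B (B w) = (\<lambda>_. 0)" by blast
      with c have "(2::nat) ^ m = 1" by simp
      then have "m = 0" by simp
      then show ?thesis using z by (simp add: outer_sum_0)
    qed
    moreover have "B w \<noteq> 0" using w by auto
    ultimately show ?thesis by (blast intro: outer_sum_Suc)
  qed
  obtain w where w: "w \<diamondop> B w = 1" using Suc.prems(2) unfolding alternating_def by (metis bit_not_zero_iff)
  show ?case
  proof (cases "\<not> alternating (upd B (B w)) \<or> upd B (B w) = (\<lambda>_. 0)")
    case True
    then show ?thesis using step w by blast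
  next
    case False
    then obtain x where x: "upd B (B w) x \<noteq> 0" by blast
    \<comment> \<open>\<open>z\<close> is \<open>x\<close> moved along \<open>w\<close> to become
      orthogonal to \<open>B w\<close>. Then \<open>w + z\<close> is again a legal choice, and
      \<open>B (w + z)\<close> differs from the one vector that makes the remainder
      alternating.\<close>
    define z where "z = x + scale (B w \<diamondop> x) w"
    have Bz: "B z = upd B (B w) x"
      by (simp add: z_def upd_def selfadj_add [OF B] selfadj_scale [OF B])
    have "B w \<diamondop> z = 0"
      using w by (simp add: z_def dot_add_right dot_commute [of "B w" w])
    moreover have diag: "\<And>x. x \<diamondop> B x = B w \<diamondop> x" using False by (simp add: alternating_upd_iff)
    ultimately have 1: "(w + z) \<diamondop> B (w + z) = 1"
      using w by (simp add: dot_add_right)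
    have "\<not> alternating (upd B (B (w + z)))"
    proof
      assume "alternating (upd B (B (w + z)))"
      then have "\<And>y. B (w + z) \<diamondop> y = B w \<diamondop> y" using diag by (simp add: alternating_upd_iff)
      then have "B (w + z) = B w" by (rule dot_eqI)
      then show False using x Bz by (simp add: selfadj_add [OF B])
    qed
    then show ?thesis using step 1 by blast
  qed
qed

text \<open>Adding the square of a nonzero \<open>B w\<close> destroys the alternating property but
  keeps the range; this is the extra summand.\<close>

lemma outer_sum_alternating:
  assumes B: "selfadj B" and alt: "alternating B" and c: "card (range B) = 2 ^ m" and "m > 0"
  shows "outer_sum (Suc m) B"
proof -
  have "B \<noteq> (\<lambda>_. 0)"
  proof
    assume "B = (\<lambda>_. 0)"
    then have "(2::nat) ^ m = 1" using c by simp
    then show False using \<open>m > 0\<close> by simp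
  qed
  then obtain w where w: "B w \<noteq> 0" by blast
  then obtain x where "B w \<diamondop> x = 1" using exists_dot_one by blast
  then have "\<not> alternating (upd B (B w))"
    using alt unfolding alternating_def form_upd by (metis add_0 zero_neq_one)
  moreover have "card (range (upd B (B w))) = 2 ^ m"
    using range_upd_alternating [OF B alt] c by simp
  ultimately have "outer_sum m (upd B (B w))"
    by (rule outer_sum_nonalternating [OF selfadj_upd [OF B]])
  then show ?thesis using w by (blast intro: outer_sum_Suc)
qed

text \<open>With \<open>A = id + B\<close> the relation says that \<open>id + C\<close> is the inverse of \<open>A\<close>; then
  \<open>B + C = A + inverse A = B \<circ> C\<close>.\<close>

definition quasi_inverse :: "('v \<Rightarrow> 'v) \<Rightarrow> ('v \<Rightarrow> 'v) \<Rightarrow> bool"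
  where "quasi_inverse B C \<longleftrightarrow> selfadj B \<and> selfadj C \<and> (\<forall>x. B (C x) = B x + C x)"

text \<open>The fourth fact is the adjoint of the third; \<open>B\<close> and \<open>C\<close>
  commute.\<close>

lemma quasi_inverseD:
  assumes "quasi_inverse B C"
  shows "selfadj B" "selfadj C" "B (C x) = B x + C x" "C (B x) = B x + C x"
proof -
  show B: "selfadj B" and C: "selfadj C" and eq: "B (C x) = B x + C x" for x
    using assms by (simp_all add: quasi_inverse_def)
  show "C (B x) = B x + C x"
  proof (rule dot_eqI)
    fix z
    have "C (B x) \<diamondop> z = x \<diamondop> B (C z)" by (simp add: selfadjD [OF B] selfadjD [OF C])
    also have "\<dots> = (B x + C x) \<diamondop> z" by (simp add: eq form_simps selfadjD [OF B] selfadjD [OF C])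
    finally show "C (B x) \<diamondop> z = (B x + C x) \<diamondop> z" .
  qed
qed

lemma quasi_inverse_sym: "quasi_inverse B C \<Longrightarrow> quasi_inverse C B"
  using quasi_inverseD [of B C] unfolding quasi_inverse_def by (simp add: add.commute)

text \<open>The relation can be solved for \<open>C x = B (C x + x)\<close>, and it is symmetric in
  \<open>B\<close> and \<open>C\<close>.\<close>

lemma quasi_inverse_range:
  assumes "quasi_inverse B C" shows "range C = range B"
proof -
  have sub: "range C \<subseteq> range B" if q: "quasi_inverse B C" for B C
  proof
    fix y assume "y \<in> range C"
    then obtain x where "y = C x" by blast
    then have "y = B (C x + x)"
      using quasi_inverseD [OF q] by (simp add: selfadj_add add_ac)
    then show "y \<in> range B" by blast
  qed
  show ?thesis using sub [OF assms] sub [OF quasi_inverse_sym [OF assms]] by blast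
qed

lemma quasi_inverse_kernel:
  assumes "quasi_inverse B C" "B x = 0" shows "C x = 0"
  using quasi_inverseD(4) [OF assms(1), of x] quasi_inverseD(2) [OF assms(1)] assms(2)
  by (simp add: selfadj_zero)

lemma quasi_inverse_cong:
  assumes q: "quasi_inverse B C" and "B x = B y" shows "C x = C y"
proof -
  have "B (x + y) = 0" using assms by (simp add: selfadj_add quasi_inverseD(1) [OF q])
  then have "C (x + y) = 0" by (rule quasi_inverse_kernel [OF q])
  then show ?thesis by (simp add: selfadj_add quasi_inverseD(2) [OF q] add_eq_zero_iff)
qed

text \<open>The Sherman-Morrison formula: \<open>v + C v\<close> is
  \<open>A\<^sup>-\<^sup>1 v\<close>, and \<open>h\<close> says that
  \<open>v\<^sup>T A\<^sup>-\<^sup>1 v = 0\<close>, which makes the denominator one.\<close>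

lemma quasi_inverse_upd:
  assumes q: "quasi_inverse B C" and h: "v \<diamondop> v + v \<diamondop> C v = 0"
  shows "quasi_inverse (upd B v) (upd C (v + C v))"
proof -
  note B = quasi_inverseD(1) [OF q] and C = quasi_inverseD(2) [OF q] and BC = quasi_inverseD(3) [OF q]
  have "upd B v (upd C (v + C v) x) = upd B v x + upd C (v + C v) x" for x
  proof -
    have h': "v \<diamondop> (v + C v) = 0" using h by (simp add: dot_add_right)
    have "upd B v (upd C (v + C v) x) =
        B (C x) + scale ((v + C v) \<diamondop> x) (B v + B (C v)) + scale (v \<diamondop> C x) v"
      by (simp add: upd_def selfadj_add [OF B] selfadj_scale [OF B] dot_add_right [of v "C x"] h' add_ac)
    also have "\<dots> = B x + C x + scale (v \<diamondop> x + v \<diamondop> C x) (C v) + scale (v \<diamondop> C x) v"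
      by (simp add: BC dot_add_left selfadjD [OF C])
    also have "\<dots> = upd B v x + upd C (v + C v) x"
      by (cases "v \<diamondop> x"; cases "v \<diamondop> C x") (simp_all add: upd_def dot_add_left selfadjD [OF C] add_ac)
    finally show ?thesis .
  qed
  then show ?thesis by (simp add: quasi_inverse_def selfadj_upd B C)
qed

text \<open>For \<open>v = B w\<close> one has \<open>A\<^sup>-\<^sup>1 v = C w\<close>, and the
  denominator condition becomes \<open>w \<diamondop> B w + w \<diamondop> C w = 0\<close>.\<close>

lemma quasi_inverse_step:
  assumes q: "quasi_inverse B C" and w: "w \<diamondop> B w = 1" "w \<diamondop> C w = 1"
  shows "quasi_inverse (upd B (B w)) (upd C (C w))"
proof -
  note Q = quasi_inverseD [OF q]
  have v: "B w + C (B w) = C w" by (simp add: Q(4))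
  have "B w \<diamondop> B w + B w \<diamondop> C (B w) = B w \<diamondop> (B w + C (B w))" by (simp only: dot_add_right)
  also have "\<dots> = w \<diamondop> B (C w)" by (simp only: v selfadjD [OF Q(1)])
  also have "\<dots> = 0" by (simp add: Q(3) dot_add_right w)
  finally show ?thesis using quasi_inverse_upd [OF q, of "B w"] v by simp
qed

text \<open>\<open>B + C\<close> is the injective operator \<open>A\<^sup>-\<^sup>1\<close> applied
  after \<open>B \<circ> B\<close>.\<close>

lemma card_range_sum_eq_square:
  assumes q: "quasi_inverse B C"
  shows "card (range (\<lambda>x. B x + C x)) = card (range (B \<circ> B))"
proof -
  note Q = quasi_inverseD [OF q]
  have eq: "(\<lambda>x. B x + C x) = (\<lambda>x. x + C x) \<circ> (B \<circ> B)"
    by (rule ext) (simp add: Q selfadj_add)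
  have "inj (\<lambda>x. x + C x)"
  proof (rule injI)
    fix x y assume "x + C x = y + C y"
    then have "x + C x + B (x + C x) = y + C y + B (y + C y)" by simp
    then show "x = y" by (simp add: Q selfadj_add add_ac)
  qed
  then have "inj_on (\<lambda>x. x + C x) (range (B \<circ> B))" by (rule inj_on_subset) simp
  then show ?thesis unfolding eq by (metis card_image fun.set_map image_comp)
qed

section \<open>Descending to the identity through invertible operators\<close>

text \<open>The range is \<open>{0, f}\<close>, and pairing with a \<open>z\<close> such that
  \<open>f \<diamondop> z = 1\<close> tells the two values apart. Self-adjointness moves this
  pairing to \<open>G z = f\<close>.\<close>

lemma rank_one_selfadj:
  assumes G: "selfadj G" and c: "card (range G) = 2"
  obtains f where "f \<noteq> 0" "\<And>x. G x = scale (f \<diamondop> x) f"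
proof -
  have "0 \<in> range G" using selfadj_zero [OF G] by (metis rangeI)
  then obtain f where f: "range G = {0, f}" "f \<noteq> 0"
    using c by (metis card_2_iff doubleton_eq_iff insertE singletonD)
  have cases: "G x = 0 \<or> G x = f" for x using f(1) by (metis insertE rangeI singletonD)
  obtain z where z: "f \<diamondop> z = 1" using exists_dot_one f(2) by blast
  have Gz: "G z = f"
  proof (rule ccontr)
    assume "G z \<noteq> f"
    then have "G z = 0" using cases by blast
    then have "G x \<diamondop> z = 0" for x by (simp add: selfadjD [OF G])
    then have "G x \<noteq> f" for x using z by (metis zero_neq_one)
    then show False using f(1) by (metis imageE insertI1 insertI2)
  qed
  have "G x = scale (f \<diamondop> x) f" for x
  proof -
    have "G x \<diamondop> z = f \<diamondop> x" by (simp add: selfadjD [OF G] Gz dot_commute [of x f])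
    then show ?thesis using cases [of x] z by auto
  qed
  with f(2) show ?thesis using that by blast
qed

lemma card_range_rank_one:
  assumes "f \<noteq> 0" shows "card (range (\<lambda>x. scale (f \<diamondop> x) f)) = 2"
proof -
  obtain z where "f \<diamondop> z = 1" using exists_dot_one assms by blast
  then have "0 = scale (f \<diamondop> 0) f" "f = scale (f \<diamondop> z) f" by simp_all
  then have "range (\<lambda>x. scale (f \<diamondop> x) f) = {0, f}"
    unfolding scale_def by (auto simp only: image_iff split: if_splits)
  then show ?thesis using assms by simp
qed

text \<open>The vectors are determined because they are orthonormal for the form induced on the range, and
  the only other vector of norm one, \<open>u + v + f\<close>, has an alternating complement.\<close>

lemma three_squares_unique:
  assumes eq: "\<And>x. scale (u \<diamondop> x) u + scale (v \<diamondop> x) v + scale (f \<diamondop> x) f =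
      scale (u' \<diamondop> x) u' + scale (v' \<diamondop> x) v' + scale (f' \<diamondop> x) f'"
    and d': "u' \<noteq> 0" "v' \<noteq> 0" "u' \<noteq> v'" "u' \<noteq> f'" "v' \<noteq> f'"
  shows "u' \<in> {u, v, f}"
proof -
  have quad: "x \<diamondop> (scale (u \<diamondop> x) u + scale (v \<diamondop> x) v + scale (f \<diamondop> x) f) = (u + v + f) \<diamondop> x" for x u v f
    by (simp add: dot_add_left dot_add_right dot_commute [of x])
  have "(u + v + f) \<diamondop> x = (u' + v' + f') \<diamondop> x" for x
    using quad [of x u v f] quad [of x u' v' f'] eq [of x] by simp
  then have diag: "u + v + f = u' + v' + f'" by (rule dot_eqI)
  show ?thesis
  proof (cases "u' + v' + f' = 0")
    case True
    \<comment> \<open>The vectors are dependent here, so the sum is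
      \<open>u' v'\<^sup>T + v' u'\<^sup>T\<close>, and a point dual to \<open>v'\<close> evaluates
      it to \<open>u'\<close>.\<close>
    obtain x where x: "v' \<diamondop> x = 1" "u' \<diamondop> x = 0" using exists_dual2 [of v' u'] d' by auto
    have f': "f' = u' + v'" using True by (metis add_eq_zero_iff)
    have f: "f = u + v" using True diag by (metis add_eq_zero_iff)
    have "u' = scale (u \<diamondop> x) u + scale (v \<diamondop> x) v + scale (f \<diamondop> x) f"
      unfolding eq using x by (simp add: f' dot_add_left add_ac)
    then show ?thesis using d'(1)
      by (cases "u \<diamondop> x"; cases "v \<diamondop> x") (auto simp: f dot_add_left add_ac)
  next
    case False
    then have "u' \<noteq> v' + f'" by (auto simp: add.assoc add_eq_zero_iff)
    then obtain x where x: "u' \<diamondop> x = 1" "v' \<diamondop> x = 0" "f' \<diamondop> x = 0"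
      using exists_dual3 [of u' v' f'] d' by auto
    have e: "u' = scale (u \<diamondop> x) u + scale (v \<diamondop> x) v + scale (f \<diamondop> x) f"
      unfolding eq using x by simp
    have "(u + v + f) \<diamondop> x = 1" using x by (simp add: diag dot_add_left)
    moreover have "u' \<noteq> u + v + f"
    proof
      assume "u' = u + v + f"
      then have "u' = u' + (v' + f')" by (metis diag add.assoc)
      then show False using d'(5) by (simp add: add_eq_zero_iff)
    qed
    ultimately show ?thesis using e
      by (cases "u \<diamondop> x"; cases "v \<diamondop> x"; cases "f \<diamondop> x") (auto simp: dot_add_left)
  qed
qed

section \<open>Counting admissible steps\<close>

text \<open>Both quadratic forms are linear, so prescribing their values cuts out cosets, whose
  images under \<open>B\<close> are translates of \<open>S\<close>. At most four pairs of values
  occur, and only two if the forms coincide.\<close>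

lemma card_range_le_admissible:
  assumes q: "quasi_inverse B C" and fin: "finite (range B)"
    and w0: "w0 \<diamondop> B w0 = 1" "w0 \<diamondop> C w0 = 1"
  defines "S \<equiv> {B w | w. w \<diamondop> B w = 1 \<and> w \<diamondop> C w = 1}"
  shows "card (range B) \<le> 4 * card S"
    and "(\<And>x. x \<diamondop> B x = x \<diamondop> C x) \<Longrightarrow> card (range B) \<le> 2 * card S"
proof -
  note Q = quasi_inverseD [OF q]
  have finS: "finite S" by (rule finite_subset [OF _ fin]) (auto simp: S_def)
  have translate: "card ((+) t ` S) = card S" for t by (simp add: card_image)
  have memS: "B t \<in> (+) (B s) ` S"
    if "(s + t) \<diamondop> B (s + t) = 1" "(s + t) \<diamondop> C (s + t) = 1" for s t
  proof
    show "B t = B s + B (s + t)" by (simp add: selfadj_add [OF Q(1)])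
    show "B (s + t) \<in> S" using that by (auto simp: S_def)
  qed
  note fa = form_add [OF Q(1)] form_add [OF Q(2)]
  have S0: "S = (+) (B 0) ` S" by (simp add: selfadj_zero [OF Q(1)])
  show "card (range B) \<le> 2 * card S" if same: "\<And>x. x \<diamondop> B x = x \<diamondop> C x"
  proof -
    have "range B \<subseteq> (+) (B 0) ` S \<union> (+) (B w0) ` S"
    proof
      fix y assume "y \<in> range B"
      then obtain x where y: "y = B x" by blast
      show "y \<in> (+) (B 0) ` S \<union> (+) (B w0) ` S"
      proof (cases "x \<diamondop> B x = 0")
        case True
        then have "y \<in> (+) (B w0) ` S" unfolding y
          using w0 same [of x] by (intro memS) (simp_all add: fa)
        then show ?thesis by blast
      next
        case False
        then have "y \<in> (+) (B 0) ` S" unfolding y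
          using same [of x] by (intro memS) (simp_all add: fa)
        then show ?thesis by blast
      qed
    qed
    then have "card (range B) \<le> card ((+) (B 0) ` S \<union> (+) (B w0) ` S)"
      by (intro card_mono) (simp_all add: finS)
    also have "\<dots> \<le> card ((+) (B 0) ` S) + card ((+) (B w0) ` S)" by (rule card_Un_le)
    finally show ?thesis by (simp add: translate)
  qed
  show "card (range B) \<le> 4 * card S"
  proof -
    \<comment> \<open>The properties of \<open>a\<close> and \<open>b\<close> are conditional on
      existence. Whenever \<open>x\<close> has to be translated by one of them,
      \<open>w0 + x\<close> proves that existence.\<close>
    obtain a where a: "(\<exists>x. x \<diamondop> B x = 1 \<and> x \<diamondop> C x = 0) \<Longrightarrow> a \<diamondop> B a = 1 \<and> a \<diamondop> C a = 0"
      by blast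
    obtain b where b: "(\<exists>x. x \<diamondop> B x = 0 \<and> x \<diamondop> C x = 1) \<Longrightarrow> b \<diamondop> B b = 0 \<and> b \<diamondop> C b = 1"
      by blast
    have "range B \<subseteq> ((+) (B 0) ` S \<union> (+) (B w0) ` S) \<union> ((+) (B a) ` S \<union> (+) (B b) ` S)"
    proof
      fix y assume "y \<in> range B"
      then obtain x where y: "y = B x" by blast
      have swap: "(w0 + x) \<diamondop> B (w0 + x) = 1 + x \<diamondop> B x" "(w0 + x) \<diamondop> C (w0 + x) = 1 + x \<diamondop> C x"
        by (simp_all add: fa w0)
      have "\<exists>s \<in> {0, w0, a, b}. (s + x) \<diamondop> B (s + x) = 1 \<and> (s + x) \<diamondop> C (s + x) = 1"
      proof (cases "x \<diamondop> B x"; cases "x \<diamondop> C x")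
        assume *: "x \<diamondop> B x = 0" "x \<diamondop> C x = 1"
        then have "a \<diamondop> B a = 1 \<and> a \<diamondop> C a = 0"
          using swap by (intro a exI [of _ "w0 + x"]) simp
        then show ?thesis using * by (simp add: fa)
      next
        assume *: "x \<diamondop> B x = 1" "x \<diamondop> C x = 0"
        then have "b \<diamondop> B b = 0 \<and> b \<diamondop> C b = 1"
          using swap by (intro b exI [of _ "w0 + x"]) simp
        then show ?thesis using * by (simp add: fa)
      qed (use w0 in \<open>simp_all add: fa\<close>)
      then show "y \<in> ((+) (B 0) ` S \<union> (+) (B w0) ` S) \<union> ((+) (B a) ` S \<union> (+) (B b) ` S)"
        unfolding y using memS by blast
    qed
    then have "card (range B) \<le> card (((+) (B 0) ` S \<union> (+) (B w0) ` S) \<union> ((+) (B a) ` S \<union> (+) (B b) ` S))"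
      by (intro card_mono) (simp_all add: finS)
    also have "\<dots> \<le> card ((+) (B 0) ` S \<union> (+) (B w0) ` S) + card ((+) (B a) ` S \<union> (+) (B b) ` S)"
      by (rule card_Un_le)
    also have "\<dots> \<le> (card ((+) (B 0) ` S) + card ((+) (B w0) ` S)) + (card ((+) (B a) ` S) + card ((+) (B b) ` S))"
      by (intro add_mono card_Un_le)
    finally show ?thesis by (simp add: translate)
  qed
qed

text \<open>A group is not the union of two proper subgroups, here the kernels of the two
  forms.\<close>

lemma exists_admissible:
  assumes q: "quasi_inverse B C" and "\<not> alternating B" "\<not> alternating C"
  obtains w where "w \<diamondop> B w = 1" "w \<diamondop> C w = 1"
proof -
  note fa = form_add [OF quasi_inverseD(1) [OF q]] form_add [OF quasi_inverseD(2) [OF q]]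
  obtain x y where xy: "x \<diamondop> B x = 1" "y \<diamondop> C y = 1"
    using assms unfolding alternating_def by (meson bit_not_zero_iff)
  show ?thesis
    by (rule that [of "if x \<diamondop> C x = 1 then x else if y \<diamondop> B y = 1 then y else x + y"])
       (use xy in \<open>auto simp: fa\<close>)
qed

section \<open>Descent by induction on the rank\<close>

text \<open>\<open>C\<close> certifies that the operator reached by the step is still
  invertible.\<close>

inductive reaches_identity :: "nat \<Rightarrow> ('v \<Rightarrow> 'v) \<Rightarrow> bool" where
  reaches_identity_0: "reaches_identity 0 (\<lambda>_. 0)"
| reaches_identity_Suc: "quasi_inverse (upd B u) C \<Longrightarrow> u \<in> range B \<Longrightarrow> u \<noteq> 0 \<Longrightarrow>
    reaches_identity k (upd B u) \<Longrightarrow> reaches_identity (Suc k) B"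

lemma reaches_identity_step:
  assumes q: "quasi_inverse B C" and w: "w \<diamondop> B w = 1" "w \<diamondop> C w = 1"
    and "reaches_identity k (upd B (B w))"
  shows "reaches_identity (Suc k) B"
proof (rule reaches_identity_Suc [OF quasi_inverse_step [OF q w]])
  show "B w \<noteq> 0" using w by auto
qed (use assms in auto)

lemma admissible_step:
  assumes q: "quasi_inverse B C" and w: "w \<diamondop> B w = 1" "w \<diamondop> C w = 1"
    and c: "card (range B) = 2 ^ Suc m"
  shows "quasi_inverse (upd B (B w)) (upd C (C w))"
    and "card (range (upd B (B w))) = 2 ^ m" "card (range (upd C (C w))) = 2 ^ m"
proof -
  show q': "quasi_inverse (upd B (B w)) (upd C (C w))" by (rule quasi_inverse_step [OF q w])
  show "card (range (upd B (B w))) = 2 ^ m"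
    using card_range_halve [OF quasi_inverseD(1) [OF q] w(1) finite_if_card_power2 [OF c]] c by simp
  then show "card (range (upd C (C w))) = 2 ^ m"
    using quasi_inverse_range [OF q'] by simp
qed

lemma reaches_identity_1:
  assumes q: "quasi_inverse B C" and c: "card (range B) = 2"
  shows "reaches_identity 1 B"
proof -
  note Q = quasi_inverseD [OF q]
  have "\<not> alternating B" "\<not> alternating C"
    using even_rank_alternating [OF Q(1), of 1] even_rank_alternating [OF Q(2), of 1] c
      quasi_inverse_range [OF q] by auto
  then obtain w where w: "w \<diamondop> B w = 1" "w \<diamondop> C w = 1" using exists_admissible [OF q] by blast
  have "card (range (upd B (B w))) = 1" using admissible_step(2) [OF q w, of 0] c by simp
  then have "upd B (B w) = (\<lambda>_. 0)" by (rule card_range_1 [OF selfadj_upd [OF Q(1)]])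
  then show ?thesis using reaches_identity_step [OF q w, of 0] reaches_identity_0 by simp
qed

lemma reaches_identity_2:
  assumes q: "quasi_inverse B C" and c: "card (range B) = 4"
    and na: "\<not> alternating B" "\<not> alternating C"
  shows "reaches_identity 2 B"
proof -
  obtain w where w: "w \<diamondop> B w = 1" "w \<diamondop> C w = 1" using exists_admissible [OF q na] by blast
  have "reaches_identity 1 (upd B (B w))"
    using reaches_identity_1 admissible_step(1,2) [OF q w, of 1] c by simp
  then show ?thesis using reaches_identity_step [OF q w, of 1] by (simp add: numeral_2_eq_2)
qed

text \<open>Both vectors represent the functional \<open>x \<diamondop> B x\<close>, and
  nondegeneracy allows only one.\<close>

lemma alternating_upd_unique:
  assumes "alternating (upd B u)" "alternating (upd B u')" shows "u = u'"
  by (rule dot_eqI) (use assms in \<open>metis alternating_upd_iff\<close>)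

lemma quasi_inverse_nonalternating:
  assumes q: "quasi_inverse B C" and "card (range B) = 2 ^ m" "odd m"
  shows "\<not> alternating B" "\<not> alternating C"
  using even_rank_alternating [of B m] even_rank_alternating [of C m] quasi_inverse_range [OF q]
    quasi_inverseD(1,2) [OF q] assms by auto

text \<open>If every admissible step makes \<open>B\<close> or \<open>C\<close> alternating, there
  are exactly two admissible values, one spoiling \<open>B\<close> and one spoiling
  \<open>C\<close>. This rigid situation forces \<open>B + C\<close> to have rank one, against
  \<open>rk\<close>.\<close>

lemma reaches_identity_3:
  assumes q: "quasi_inverse B C" and c: "card (range B) = 8"
    and rk: "card (range (\<lambda>x. B x + C x)) \<noteq> 2"
  shows "reaches_identity 3 B"
proof -
  note Q = quasi_inverseD [OF q]
  note fa = form_add [OF Q(1)] form_add [OF Q(2)]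
  have fin: "finite (range B)" using c finite_if_card_power2 [of "range B" 3] by simp
  define S where "S = {B w | w. w \<diamondop> B w = 1 \<and> w \<diamondop> C w = 1}"
  have finS: "finite S" by (rule finite_subset [OF _ fin]) (auto simp: S_def)
  have na: "\<not> alternating B" "\<not> alternating C" using quasi_inverse_nonalternating [OF q, of 3] c by simp_all
  obtain w0 where w0: "w0 \<diamondop> B w0 = 1" "w0 \<diamondop> C w0 = 1" using exists_admissible [OF q na] by blast
  note cardS = card_range_le_admissible [OF q fin w0, folded S_def]
  have "\<exists>w. w \<diamondop> B w = 1 \<and> w \<diamondop> C w = 1 \<and> \<not> alternating (upd B (B w)) \<and> \<not> alternating (upd C (C w))"
  proof (rule ccontr)
    assume no: "\<not> ?thesis"
    have bad: "alternating (upd B (B w)) \<or> alternating (upd C (C w))"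
      if "w \<diamondop> B w = 1" "w \<diamondop> C w = 1" for w using no that by blast
    have uniqB: "B w = B w'" if "alternating (upd B (B w))" "alternating (upd B (B w'))" for w w'
      using alternating_upd_unique that by blast
    have uniqC: "B w = B w'" if "alternating (upd C (C w))" "alternating (upd C (C w'))" for w w'
      using alternating_upd_unique [OF that] quasi_inverse_cong [OF quasi_inverse_sym [OF q]] by blast
    have two: "card S \<ge> 2" using cardS(1) c by simp
    have "\<exists>w1 w2. w1 \<diamondop> B w1 = 1 \<and> w1 \<diamondop> C w1 = 1 \<and> w2 \<diamondop> B w2 = 1 \<and> w2 \<diamondop> C w2 = 1 \<and> B w1 \<noteq> B w2"
    proof (rule ccontr)
      assume "\<not> ?thesis"
      then have "S \<subseteq> {B w0}" using w0 unfolding S_def by blast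
      then have "card S \<le> 1" using card_mono [of "{B w0}" S] by simp
      then show False using two by simp
    qed
    \<comment> \<open>Each kind of failure determines the value of \<open>B\<close>, so two
      different values fail for different reasons.\<close>
    then obtain w1 w2 where w12: "w1 \<diamondop> B w1 = 1" "w1 \<diamondop> C w1 = 1" "w2 \<diamondop> B w2 = 1" "w2 \<diamondop> C w2 = 1"
        "B w1 \<noteq> B w2" "alternating (upd B (B w1))" "alternating (upd C (C w2))"
      using bad uniqB uniqC by metis
    have S: "B w = B w1 \<or> B w = B w2" if "w \<diamondop> B w = 1" "w \<diamondop> C w = 1" for w
      using bad [OF that] uniqB [OF w12(6)] uniqC [OF w12(7)] by metis
    then have "S \<subseteq> {B w1, B w2}" unfolding S_def by blast
    then have "card S \<le> 2" using card_mono [of "{B w1, B w2}" S] card_insert_le_m1 [of 2 "{B w2}" "B w1"] by simp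
    \<comment> \<open>If the two forms agreed, at least four of the eight values would be
      admissible.\<close>
    then obtain x where x: "x \<diamondop> B x \<noteq> x \<diamondop> C x" using cardS(2) c by fastforce
    have lam: "x \<diamondop> B x = B w1 \<diamondop> x" and mu: "x \<diamondop> C x = C w2 \<diamondop> x" for x
      using w12(6,7) by (simp_all add: alternating_upd_iff)
    \<comment> \<open>\<open>w1\<close>, \<open>p = w1 + w2\<close> and \<open>q\<close> span modulo the kernel of \<open>B\<close>; \<open>B + C\<close> kills \<open>p\<close> and \<open>w1\<close>, so it has rank one.\<close>
    define q where "q = (if x \<diamondop> B x = 1 then x else w1 + x)"
    have q: "q \<diamondop> B q = 1" "q \<diamondop> C q = 0"
      using x w12(1,2) unfolding q_def by (cases "x \<diamondop> B x"; cases "x \<diamondop> C x"; simp add: fa)+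
    define p where "p = w1 + w2"
    have Bp: "B p \<noteq> 0" using w12(5) by (simp add: p_def selfadj_add [OF Q(1)] add_eq_zero_iff)
    have Cp: "C p \<noteq> 0" using Bp quasi_inverse_kernel [OF quasi_inverse_sym [OF \<open>quasi_inverse B C\<close>]] by blast
    have p: "p \<diamondop> B p = 0" "p \<diamondop> C p = 0" using w12 by (simp_all add: p_def fa)
    have span: "B x \<in> {B y | y. y \<in> {0, p, w1, w1 + p, q, q + p, q + w1, q + w1 + p}}" for x
    proof -
      \<comment> \<open>Adding \<open>w1\<close> turns a common zero of both forms into an
        admissible vector, whose value is already known.\<close>
      have span0: "B y \<in> {B 0, B p}" if "y \<diamondop> B y = 0" "y \<diamondop> C y = 0" for y
      proof -
        have "B (w1 + y) = B w1 \<or> B (w1 + y) = B w2" by (rule S) (simp_all add: fa that w12)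
        then show ?thesis
          by (auto simp: selfadj_add [OF Q(1)] selfadj_zero [OF Q(1)] p_def add_eq_swap [of "B w1"] add.commute)
      qed
      \<comment> \<open>The pairs of form values are \<open>(1, 1)\<close> at \<open>w1\<close>,
        \<open>(1, 0)\<close> at \<open>q\<close> and \<open>(0, 1)\<close> at
        \<open>q + w1\<close>, so \<open>t\<close> can cancel those of \<open>x\<close>.\<close>
      obtain t where t: "t \<in> {0, w1, q, q + w1}" "(t + x) \<diamondop> B (t + x) = 0" "(t + x) \<diamondop> C (t + x) = 0"
      proof
        let ?t = "if x \<diamondop> B x = 0 then if x \<diamondop> C x = 0 then 0 else q + w1
                  else if x \<diamondop> C x = 0 then q else w1"
        show "?t \<in> {0, w1, q, q + w1}" by simp
        show "(?t + x) \<diamondop> B (?t + x) = 0" "(?t + x) \<diamondop> C (?t + x) = 0"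
          by (cases "x \<diamondop> B x"; cases "x \<diamondop> C x"; simp add: fa q w12)+
      qed
      have "B x = B t + B (t + x)" by (simp add: selfadj_add [OF Q(1)])
      then have "B x = B (t + 0) \<or> B x = B (t + p)"
        using span0 [OF t(2,3)] by (auto simp only: selfadj_add [OF Q(1)] insert_iff empty_iff)
      then show ?thesis using t(1) by auto
    qed
    \<comment> \<open>The range is orthogonal to the kernel, and \<open>p\<close>,
      \<open>w1\<close>, \<open>q\<close> generate the space modulo the kernel. So three products
      decide whether an element of the range vanishes.\<close>
    have zero_if: "g = 0" if g: "g \<in> range B" "g \<diamondop> p = 0" "g \<diamondop> w1 = 0" "g \<diamondop> q = 0" for g
    proof (rule dot_nondegenerate)
      fix x
      obtain z where z: "g = B z" using g(1) by blast
      obtain y where y: "y \<in> {0, p, w1, w1 + p, q, q + p, q + w1, q + w1 + p}" "B x = B y"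
        using span by blast
      have "g \<diamondop> x = g \<diamondop> y" by (simp add: z selfadjD [OF Q(1)] y)
      then show "g \<diamondop> x = 0" using y(1) g by (auto simp: dot_add_right)
    qed
    have rC: "C x \<in> range B" for x using quasi_inverse_range [OF \<open>quasi_inverse B C\<close>] by blast
    have Bw1p: "B w1 \<diamondop> p = 0" using p lam by metis
    then have Bpw1: "B p \<diamondop> w1 = 0" by (metis selfadjD [OF Q(1)] dot_commute)
    have "C w2 \<diamondop> p = 0" using p mu by metis
    then have "C p \<diamondop> w2 = 0" by (metis selfadjD [OF Q(2)] dot_commute)
    moreover have "C p \<diamondop> p = 0" using p by (simp add: dot_commute)
    moreover have "w1 = w2 + p" by (simp add: p_def add_ac)
    ultimately have Cpw1: "C p \<diamondop> w1 = 0" by (simp add: dot_add_right)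
    have Bpp: "B p \<diamondop> p = 0" "C p \<diamondop> p = 0" using p by (simp_all add: dot_commute)
    have Bpq: "B p \<diamondop> q = 1" using zero_if [of "B p"] Bp Bpp Bpw1 by (metis bit_not_one_iff rangeI)
    have Cpq: "C p \<diamondop> q = 1" using zero_if [of "C p"] Cp Bpp Cpw1 rC by (metis bit_not_one_iff)
    have sumr: "B y + C y \<in> range B" for y using Q(3) [of y] by (metis rangeI)
    have Dp: "B p + C p = 0"
      by (rule zero_if [OF sumr]) (simp_all add: dot_add_left Bpp Bpw1 Cpw1 Bpq Cpq)
    have "C w1 \<diamondop> q = 0 + C p \<diamondop> q"
      using q mu [of q] \<open>w1 = w2 + p\<close> by (simp add: selfadj_add [OF Q(2)] dot_add_left)
    moreover have "B w1 \<diamondop> q = 1" using q lam by metis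
    moreover have "C w1 \<diamondop> p = 0" using Cpw1 by (metis selfadjD [OF Q(2)] dot_commute)
    moreover have "B w1 \<diamondop> w1 = 1" "C w1 \<diamondop> w1 = 1" using w12 by (simp_all add: dot_commute [of _ w1])
    ultimately have Dw1: "B w1 + C w1 = 0"
      by (intro zero_if [OF sumr]) (simp_all add: dot_add_left Bw1p Cpq)
    have Dq: "B q + C q \<noteq> 0"
      using q by (metis add_eq_zero_iff zero_neq_one)
    have "range (\<lambda>x. B x + C x) = {0, B q + C q}"
    proof
      show "range (\<lambda>x. B x + C x) \<subseteq> {0, B q + C q}"
      proof
        fix d assume "d \<in> range (\<lambda>x. B x + C x)"
        then obtain x where d: "d = B x + C x" by blast
        obtain y where y: "y \<in> {0, p, w1, w1 + p, q, q + p, q + w1, q + w1 + p}" "B x = B y"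
          using span by blast
        have "d = B y + C y" using d y(2) quasi_inverse_cong [OF \<open>quasi_inverse B C\<close> y(2)] by simp
        moreover have "B (s + t) + C (s + t) = (B s + C s) + (B t + C t)" for s t
          by (simp add: selfadj_add [OF Q(1)] selfadj_add [OF Q(2)] add_ac)
        ultimately show "d \<in> {0, B q + C q}" using y(1)
          by (auto simp: Dp Dw1 selfadj_zero [OF Q(1)] selfadj_zero [OF Q(2)])
      qed
      show "{0, B q + C q} \<subseteq> range (\<lambda>x. B x + C x)"
        using Dp by (auto simp: image_iff)
    qed
    then have "card (range (\<lambda>x. B x + C x)) = 2" using Dq by simp
    then show False using rk by simp
  qed
  then obtain w where w: "w \<diamondop> B w = 1" "w \<diamondop> C w = 1"
    and na': "\<not> alternating (upd B (B w))" "\<not> alternating (upd C (C w))" by blast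
  have "reaches_identity 2 (upd B (B w))"
    using reaches_identity_2 [OF _ _ na'] admissible_step(1,2) [OF q w, of 2] c by simp
  then show ?thesis using reaches_identity_step [OF q w, of 2] by (simp add: numeral_3_eq_3)
qed

text \<open>Such a step exhibits \<open>B + C\<close> as a sum of three squares, one of them that of
  the step vector. The three vectors are determined by the sum, so all these steps draw from one
  triple.\<close>

lemma card_rank_one_steps:
  assumes q: "quasi_inverse B C" and rk: "card (range (\<lambda>x. B x + C x)) \<noteq> 2"
  defines "X \<equiv> {B w | w. w \<diamondop> B w = 1 \<and> w \<diamondop> C w = 1 \<and>
      card (range (\<lambda>x. upd B (B w) x + upd C (C w) x)) = 2}"
  shows "finite X \<and> card X \<le> 3"
proof -
  note Q = quasi_inverseD [OF q]
  have ex: "\<exists>v f. (\<forall>x. B x + C x = scale (u \<diamondop> x) u + scale (v \<diamondop> x) v + scale (f \<diamondop> x) f) \<and>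
      u \<noteq> 0 \<and> v \<noteq> 0 \<and> u \<noteq> v \<and> u \<noteq> f \<and> v \<noteq> f" if u: "u \<in> X" for u
  proof -
    obtain w where w: "u = B w" "w \<diamondop> B w = 1" "w \<diamondop> C w = 1"
      "card (range (\<lambda>x. upd B (B w) x + upd C (C w) x)) = 2"
      using u unfolding X_def by blast
    obtain f where f: "f \<noteq> 0" "\<And>x. upd B (B w) x + upd C (C w) x = scale (f \<diamondop> x) f"
      using rank_one_selfadj [OF selfadj_sum [OF selfadj_upd [OF Q(1)] selfadj_upd [OF Q(2)]] w(4)] by blast
    have D: "B x + C x = scale (B w \<diamondop> x) (B w) + scale (C w \<diamondop> x) (C w) + scale (f \<diamondop> x) f" for x
      by (simp add: f(2) [symmetric] upd_def add_ac)
    have dots: "B w \<diamondop> w = 1" "C w \<diamondop> w = 1" using w by (simp_all add: dot_commute [of _ w])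
    \<comment> \<open>Both updated operators kill \<open>w\<close>, so \<open>f\<close> is
      orthogonal to \<open>w\<close>; \<open>B w\<close> and \<open>C w\<close> are not, hence
      differ from \<open>f\<close>.\<close>
    have "scale (f \<diamondop> w) f = 0" using f(2) [of w] by (simp add: upd_def dots)
    then have fw: "f \<diamondop> w = 0" using f(1) by (cases "f \<diamondop> w") simp_all
    \<comment> \<open>Equal vectors would cancel and leave \<open>B + C\<close> itself of rank
      one.\<close>
    have "B w \<noteq> C w"
    proof
      assume "B w = C w"
      then have "(\<lambda>x. B x + C x) = (\<lambda>x. scale (f \<diamondop> x) f)" by (auto simp: D)
      then show False using rk card_range_rank_one [OF f(1)] by metis
    qed
    moreover have "B w \<noteq> 0" "C w \<noteq> 0" "B w \<noteq> f" "C w \<noteq> f" using dots fw by auto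
    ultimately show ?thesis using D w(1) by blast
  qed
  show ?thesis
  proof (cases "X = {}")
    case True then show ?thesis by simp
  next
    case False
    then obtain u where "u \<in> X" by blast
    then obtain v f where D: "\<And>x. B x + C x = scale (u \<diamondop> x) u + scale (v \<diamondop> x) v + scale (f \<diamondop> x) f"
      using ex by blast
    have sub: "X \<subseteq> {u, v, f}"
    proof
      fix u' assume "u' \<in> X"
      then obtain v' f' where D': "\<And>x. B x + C x = scale (u' \<diamondop> x) u' + scale (v' \<diamondop> x) v' + scale (f' \<diamondop> x) f'"
        and d: "u' \<noteq> 0" "v' \<noteq> 0" "u' \<noteq> v'" "u' \<noteq> f'" "v' \<noteq> f'"
        using ex by blast
      show "u' \<in> {u, v, f}"
        by (rule three_squares_unique [OF _ d]) (simp only: D [symmetric] D' [symmetric])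
    qed
    have "card {u, v, f} \<le> 3" by (simp add: card_insert_if)
    then show ?thesis using sub by (meson card_mono finite.emptyI finite_insert finite_subset le_trans)
  qed
qed

text \<open>Induction from rank three upwards, comparing the supply of admissible values with the
  number of forbidden ones so that one step preserves all conditions.\<close>

lemma reaches_identity_of_rank:
  assumes "quasi_inverse B C" "card (range B) = 2 ^ m" "m \<ge> 3"
    "\<not> alternating B" "\<not> alternating C" "card (range (\<lambda>x. B x + C x)) \<noteq> 2"
  shows "reaches_identity m B"
  using assms(3,1,2,4-)
proof (induction m arbitrary: B C rule: dec_induct)
  case base
  then show ?case using reaches_identity_3 by simp
next
  case (step m)
  note q = step.prems(1) and c = step.prems(2)
  have fin: "finite (range B)" by (rule finite_if_card_power2 [OF c])
  define S where "S = {B w | w. w \<diamondop> B w = 1 \<and> w \<diamondop> C w = 1}"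
  define X where "X = {B w | w. w \<diamondop> B w = 1 \<and> w \<diamondop> C w = 1 \<and>
      card (range (\<lambda>x. upd B (B w) x + upd C (C w) x)) = 2}"
  define Y where "Y = {B w | w. alternating (upd B (B w))}"
  define Z where "Z = {B w | w. alternating (upd C (C w))}"
  obtain w0 where w0: "w0 \<diamondop> B w0 = 1" "w0 \<diamondop> C w0 = 1"
    using exists_admissible [OF q step.prems(3,4)] by blast
  have "4 * 2 ^ (m - 1) = (2::nat) ^ Suc m" using step.hyps by (cases m) simp_all
  then have S: "card S \<ge> 2 ^ (m - 1)"
    using card_range_le_admissible(1) [OF q fin w0, folded S_def] c by linarith
  have X: "finite X" "card X \<le> 3"
    using card_rank_one_steps [OF q step.prems(5), folded X_def] by simp_all
  have "y = y'" if "y \<in> Y" "y' \<in> Y" for y y'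
    using that alternating_upd_unique unfolding Y_def by blast
  then have Y: "finite Y" "card Y \<le> 1"
    by (metis (no_types, lifting) finite.simps is_singletonI' is_singleton_def card.empty card_1_singleton_iff One_nat_def le_numeral_extra(4) zero_le)+
  have "y = y'" if "y \<in> Z" "y' \<in> Z" for y y'
    using that alternating_upd_unique [of C] quasi_inverse_cong [OF quasi_inverse_sym [OF q]]
    unfolding Z_def by blast
  then have Z: "finite Z" "card Z \<le> 1"
    by (metis (no_types, lifting) finite.simps is_singletonI' is_singleton_def card.empty card_1_singleton_iff One_nat_def le_numeral_extra(4) zero_le)+
  have "\<exists>w. w \<diamondop> B w = 1 \<and> w \<diamondop> C w = 1 \<and> B w \<notin> X \<and>
      \<not> alternating (upd B (B w)) \<and> \<not> alternating (upd C (C w))"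
  \<comment> \<open>The rank after the step is \<open>m\<close>. If it is odd, nothing can become
    alternating and four values beat the three in \<open>X\<close>; if it is even, then
    \<open>m \<ge> 4\<close> and eight values beat five.\<close>
  proof (cases "odd m")
    case True
    have "(2::nat) ^ 2 \<le> 2 ^ (m - 1)" using step.hyps by (intro power_increasing) simp_all
    then have "card X < card S" using X S by simp
    then have "\<not> S \<subseteq> X" using X(1) card_mono by (metis leD)
    then obtain w where w: "w \<diamondop> B w = 1" "w \<diamondop> C w = 1" "B w \<notin> X" unfolding S_def by blast
    moreover have "\<not> alternating (upd B (B w))" "\<not> alternating (upd C (C w))"
      using quasi_inverse_nonalternating [OF admissible_step(1,2) [OF q w(1,2) c] True] by simp_all
    ultimately show ?thesis by blast
  next
    case False
    then have "m \<ge> 4" using step.hyps by (cases "m = 3") auto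
    then have "(2::nat) ^ 3 \<le> 2 ^ (m - 1)" by (intro power_increasing) simp_all
    moreover have "card (X \<union> (Y \<union> Z)) \<le> 5"
      using X Y Z card_Un_le [of X "Y \<union> Z"] card_Un_le [of Y Z] by linarith
    ultimately have "card (X \<union> (Y \<union> Z)) < card S" using S by simp
    then have "\<not> S \<subseteq> X \<union> (Y \<union> Z)" using X(1) Y(1) Z(1) card_mono by (metis finite_UnI leD)
    then show ?thesis unfolding S_def Y_def Z_def by blast
  qed
  then obtain w where w: "w \<diamondop> B w = 1" "w \<diamondop> C w = 1" "B w \<notin> X"
    "\<not> alternating (upd B (B w))" "\<not> alternating (upd C (C w))" by blast
  have "card (range (\<lambda>x. upd B (B w) x + upd C (C w) x)) \<noteq> 2"
    using w(1-3) unfolding X_def by blast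
  then have "reaches_identity m (upd B (B w))"
    using step.IH [OF admissible_step(1,2) [OF q w(1,2) c]] w(4,5) by blast
  then show ?case by (rule reaches_identity_step [OF q w(1,2)])
qed

section \<open>Ranks of squares and operators on a finite subspace\<close>

lemma card_eq_image_times_kernel:
  assumes fin: "finite V" and add: "\<And>x y. x \<in> V \<Longrightarrow> y \<in> V \<Longrightarrow> x + y \<in> V" and B: "selfadj B"
  shows "card V = card (B ` V) * card {x \<in> V. B x = 0}"
proof -
  have fibre: "card {x \<in> V. B x = y} = card {x \<in> V. B x = 0}" if y: "y \<in> B ` V" for y
  proof -
    obtain a where a: "a \<in> V" "y = B a" using y by blast
    have "bij_betw ((+) a) {x \<in> V. B x = 0} {x \<in> V. B x = y}"
      by (rule bij_betw_byWitness [where f' = "(+) a"]) (auto simp: add a selfadj_add [OF B])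
    from bij_betw_same_card [OF this] show ?thesis by simp
  qed
  have "card V = (\<Sum>x\<in>V. 1)" by simp
  also have "\<dots> = (\<Sum>y\<in>B ` V. \<Sum>x | x \<in> V \<and> B x = y. 1)"
    by (rule sum.group [symmetric]) (simp_all add: fin)
  also have "\<dots> = (\<Sum>y\<in>B ` V. card {x \<in> V. B x = 0})"
    by (rule sum.cong) (simp_all add: fibre)
  finally show ?thesis by simp
qed

lemma card_range_square:
  assumes B: "selfadj B" and fin: "finite (range B)"
  shows "card (range B) = card (range (B \<circ> B)) * card {x \<in> range B. B x = 0}"
proof -
  have "card (range B) = card (B ` range B) * card {x \<in> range B. B x = 0}"
    by (rule card_eq_image_times_kernel [OF fin _ B]) (auto simp flip: selfadj_add [OF B])
  then show ?thesis by (simp add: image_comp)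
qed

end

text \<open>\<open>V\<close> plays the role of the column vectors of length \<open>n\<close> inside
  the ambient type; kernels are counted within it.\<close>

locale binary_subspace = binary_form dot for dot :: "'v::ab_group_add \<Rightarrow> 'v \<Rightarrow> bit" (infixl "\<diamondop>" 70) +
  fixes V :: "'v set"
  assumes finite_V: "finite V"
    and add_V: "x \<in> V \<Longrightarrow> y \<in> V \<Longrightarrow> x + y \<in> V"
    and nondegenerate_V: "x \<in> V \<Longrightarrow> (\<And>y. y \<in> V \<Longrightarrow> x \<diamondop> y = 0) \<Longrightarrow> x = 0"
begin

lemma card_kernel_V:
  assumes "selfadj B" "B ` V = range B" "card V = 2 ^ (k + l)" "card (range B) = 2 ^ k"
  shows "card {x \<in> V. B x = 0} = 2 ^ l"
  using card_eq_image_times_kernel [OF finite_V add_V assms(1)] assms(2-) by (simp add: power_add)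

text \<open>The range, of dimension \<open>k\<close>, meets the kernel in dimension at most
  \<open>n - k\<close>, so \<open>B \<circ> B\<close> and with it \<open>B + C\<close> has rank at
  least \<open>2 * k - n \<ge> 3\<close>.\<close>

lemma reaches_identity_large_odd_rank:
  assumes q: "quasi_inverse B C" and im: "B ` V = range B" and sub: "range B \<subseteq> V"
    and V: "card V = 2 ^ n" and c: "card (range B) = 2 ^ k" and "odd k" and nk: "n + 3 \<le> 2 * k"
  shows "reaches_identity k B"
proof -
  note Q = quasi_inverseD [OF q]
  have "(2::nat) ^ k \<le> 2 ^ n" using card_mono [OF finite_V sub] V c by simp
  then have kn: "k \<le> n" by (rule power_le_imp_le_exp [rotated]) simp
  have fin: "finite (range B)" by (rule finite_if_card_power2 [OF c])
  have ker: "card {x \<in> V. B x = 0} = 2 ^ (n - k)"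
    by (rule card_kernel_V [OF Q(1) im _ c]) (use V kn in simp)
  have le: "card {x \<in> range B. B x = 0} \<le> card {x \<in> V. B x = 0}"
    by (rule card_mono) (use finite_V sub in auto)
  have "2 ^ k = card (range (B \<circ> B)) * card {x \<in> range B. B x = 0}"
    using card_range_square [OF Q(1) fin] c by simp
  also have "\<dots> \<le> card (range (B \<circ> B)) * 2 ^ (n - k)"
    using le ker by (intro mult_le_mono2) simp
  finally have "2 ^ k \<le> card (range (B \<circ> B)) * 2 ^ (n - k)" .
  moreover have "(2::nat) ^ Suc (n - k) < 2 ^ k"
    using nk kn by (intro power_strict_increasing) auto
  ultimately have "card (range (B \<circ> B)) \<noteq> 2" by auto
  then have "card (range (\<lambda>x. B x + C x)) \<noteq> 2" by (simp add: card_range_sum_eq_square [OF q])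
  moreover have "k \<ge> 3" using nk kn by simp
  ultimately show ?thesis
    using reaches_identity_of_rank [OF q c] quasi_inverse_nonalternating [OF q c \<open>odd k\<close>] by blast
qed

text \<open>If \<open>w \<diamondop> v = 1\<close> for some \<open>w\<close> in the kernel, then
  \<open>v\<close> is outside the range, so the update has odd rank \<open>k + 1\<close> and cannot
  alternate. The choice of \<open>w\<close> must permit an invertible update and keep the new square
  from having rank one.\<close>

lemma alternating_step:
  assumes q: "quasi_inverse B C" and alt: "alternating B"
    and im: "B ` V = range B" and sub: "range B \<subseteq> V"
    and V: "card V = 2 ^ (2 * k + 1)" and c: "card (range B) = 2 ^ k" and k: "k \<ge> 2"
    and odd: "\<And>w. w \<in> V \<Longrightarrow> w \<diamondop> w = 0 \<Longrightarrow> \<exists>y\<in>V. y \<diamondop> y \<noteq> w \<diamondop> y"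
  obtains v C' where "v \<in> V" "v \<noteq> 0" "quasi_inverse (upd B v) C'" "reaches_identity (Suc k) (upd B v)"
proof -
  note Q = quasi_inverseD [OF q]
  have fin: "finite (range B)" by (rule finite_if_card_power2 [OF c])
  \<comment> \<open>\<open>upd B v\<close> is again quasi-invertible iff \<open>h v = 0\<close>.\<close>
  define h where "h v = v \<diamondop> v + v \<diamondop> C v" for v
  have h_add: "h (x + y) = h x + h y" for x y
  proof -
    have "selfadj (\<lambda>x. x + C x)" using Q(2) by (simp add: selfadj_def dot_add_left dot_add_right)
    from form_add [OF this, of x y] show ?thesis by (simp add: h_def dot_add_right)
  qed
  \<comment> \<open>Solving \<open>w \<diamondop> v = 1\<close> and \<open>h v = 0\<close> together
    requires that \<open>w\<close> does not represent \<open>h\<close> on \<open>V\<close>. When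
    \<open>B \<circ> B\<close> has rank at most one, \<open>w\<close> is also taken from the range,
    to make the new square larger.\<close>
  have "\<exists>w\<in>V. w \<noteq> 0 \<and> B w = 0 \<and> (\<exists>v\<in>V. h v \<noteq> w \<diamondop> v) \<and> (card (range (B \<circ> B)) \<le> 2 \<longrightarrow> w \<in> range B)"
  proof (cases "card (range (B \<circ> B)) \<le> 2")
    case True
    have "(2::nat) ^ 2 \<le> 2 ^ k" using k by (intro power_increasing) simp_all
    then have "4 \<le> card (range (B \<circ> B)) * card {x \<in> range B. B x = 0}"
      using card_range_square [OF Q(1) fin] c by simp
    also have "\<dots> \<le> 2 * card {x \<in> range B. B x = 0}" using True by (rule mult_le_mono1)
    finally have "\<not> {x \<in> range B. B x = 0} \<subseteq> {0}"
      using card_mono [of "{0}" "{x \<in> range B. B x = 0}"] by auto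
    then obtain w where w: "w \<in> range B" "B w = 0" "w \<noteq> 0" by blast
    have wV: "w \<in> V" using w sub by blast
    obtain z where "w = B z" using w by blast
    then have ww: "w \<diamondop> w = 0" using w(2) by (simp add: selfadjD [OF Q(1)])
    then obtain y where y: "y \<in> V" "y \<diamondop> y \<noteq> w \<diamondop> y" using odd wV by blast
    \<comment> \<open>This vector is \<open>A y\<close>. As \<open>h\<close> is the form of
      \<open>A\<^sup>-\<^sup>1\<close>, its value there is \<open>y \<diamondop> A y\<close>, which
      is \<open>y \<diamondop> y\<close> for alternating \<open>B\<close>; this carries
      \<open>odd\<close> over to \<open>h\<close>.\<close>
    have "y + B y \<in> V" using add_V y sub by blast
    moreover have "h (y + B y) = y \<diamondop> y"
    proof -
      have "h (y + B y) = (y + B y) \<diamondop> (y + B y + C (y + B y))" by (simp add: h_def dot_add_right)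
      also have "y + B y + C (y + B y) = y" by (simp add: selfadj_add [OF Q(2)] Q(4) add_ac)
      also have "(y + B y) \<diamondop> y = y \<diamondop> y" using alt by (simp add: dot_add_left selfadjD [OF Q(1)] alternating_def)
      finally show ?thesis .
    qed
    moreover have "w \<diamondop> (y + B y) = w \<diamondop> y"
      using w(2) by (simp add: dot_add_right selfadjD [OF Q(1), symmetric])
    ultimately show ?thesis using w wV y by metis
  next
    case False
    have ker: "card {x \<in> V. B x = 0} = 2 ^ Suc k"
      by (rule card_kernel_V [OF Q(1) im _ c]) (simp add: V)
    \<comment> \<open>By nondegeneracy at most one vector represents \<open>h\<close>, so a kernel
      with more than two elements contains a suitable \<open>w\<close>.\<close>
    let ?H = "{w \<in> V. \<forall>v\<in>V. h v = w \<diamondop> v}"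
    have "w = w'" if w: "w \<in> ?H" "w' \<in> ?H" for w w'
    proof -
      have "w + w' = 0"
        by (rule nondegenerate_V) (use w in \<open>auto simp: add_V dot_add_left bit_add_eq_0_iff\<close>)
      then show ?thesis by (simp add: add_eq_zero_iff)
    qed
    then obtain w0 where "?H \<subseteq> {w0}" by blast
    then have "{x \<in> V. B x = 0} \<subseteq> {0, w0}" if "{x \<in> V. B x = 0} \<subseteq> insert 0 ?H" using that by blast
    then have "card {x \<in> V. B x = 0} \<le> 2" if "{x \<in> V. B x = 0} \<subseteq> insert 0 ?H"
      using that card_mono [of "{0, w0}" "{x \<in> V. B x = 0}"] card_insert_le_m1 [of 2 "{w0}" 0] by simp
    moreover have "(2::nat) ^ 2 \<le> 2 ^ Suc k" using k by (intro power_increasing) simp_all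
    ultimately have "\<not> {x \<in> V. B x = 0} \<subseteq> insert 0 ?H" using ker by auto
    then show ?thesis using False by blast
  qed
  then obtain w where w: "w \<in> V" "w \<noteq> 0" "B w = 0" "\<exists>v\<in>V. h v \<noteq> w \<diamondop> v"
      "card (range (B \<circ> B)) \<le> 2 \<Longrightarrow> w \<in> range B" by blast
  obtain v0 where v0: "v0 \<in> V" "h v0 \<noteq> w \<diamondop> v0" using w(4) by blast
  obtain v1 where v1: "v1 \<in> V" "w \<diamondop> v1 = 1" using nondegenerate_V [OF w(1)] w(2) by (metis bit_not_zero_iff)
  obtain v where v: "v \<in> V" "w \<diamondop> v = 1" "h v = 0"
  proof
    \<comment> \<open>\<open>v0\<close> separates the two functionals: either it already works, or
      \<open>w \<diamondop> v0 = 0\<close> and \<open>h v0 = 1\<close>, and then it corrects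
      \<open>h v1\<close>.\<close>
    let ?v = "if w \<diamondop> v0 = 1 then v0 else if h v1 = 0 then v1 else v1 + v0"
    show "?v \<in> V" using v0 v1 add_V by simp
    show "w \<diamondop> ?v = 1" "h ?v = 0"
      by (use v0 v1 in \<open>cases "w \<diamondop> v0"; cases "h v0"; cases "h v1"; simp add: dot_add_right h_add\<close>)+
  qed
  define B' where "B' = upd B v"
  define C' where "C' = upd C (v + C v)"
  have q': "quasi_inverse B' C'" unfolding B'_def C'_def
    by (rule quasi_inverse_upd [OF q]) (use v(3) in \<open>simp add: h_def\<close>)
  note Q' = quasi_inverseD [OF q']
  have B'w: "B' w = v" using v(2) w(3) by (simp add: B'_def upd_def dot_commute [of v w])
  \<comment> \<open>Updating \<open>B'\<close> by \<open>B' w = v\<close> restores \<open>B\<close>,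
    so the halving of ranges is read backwards.\<close>
  have c': "card (range B') = 2 ^ Suc k"
    using card_range_halve [OF Q'(1), of w] B'w v(2) c finite_range_upd [OF fin, of v]
    by (simp add: B'_def)
  \<comment> \<open>\<open>B\<close> is \<open>B'\<close> after the projection along
    \<open>w\<close>.\<close>
  have B_B': "B y = B' (y + scale (v \<diamondop> y) w)" for y
    by (simp add: selfadj_add [OF Q'(1)] selfadj_scale [OF Q'(1)] B'w) (simp add: B'_def upd_def add.assoc)
  have fin': "finite (range (B' \<circ> B'))"
    unfolding image_comp [symmetric] by (rule finite_imageI) (simp add: B'_def finite_range_upd fin)
  have "card (range (B' \<circ> B')) \<noteq> 2"
  proof (cases "card (range (B \<circ> B)) \<le> 2")
    case True
    then obtain y0 where y0: "w = B y0" using w(5) by blast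
    define y1 where "y1 = y0 + scale (v \<diamondop> y0) w"
    have y1: "B' y1 = w" by (metis B_B' y0 y1_def)
    have "w \<diamondop> w = 0" using selfadjD [OF Q(1), of y0 w] w(3) y0 by simp
    then have a: "B' (B' y1) \<diamondop> y1 = 0" using selfadjD [OF Q'(1), of w y1] by (simp add: y1)
    have b: "B' (B' y1) \<diamondop> w = 1" by (simp add: y1 B'w v(2) dot_commute [of v w])
    have "B' (B' w) \<diamondop> y1 = 1" using b by (metis selfadjD [OF Q'(1)] dot_commute)
    then have "0 \<noteq> B' (B' y1)" "0 \<noteq> B' (B' w)" "B' (B' y1) \<noteq> B' (B' w)" using a b by auto
    then have "card {0, B' (B' y1), B' (B' w)} = 3" by simp
    moreover have "{0, B' (B' y1), B' (B' w)} \<subseteq> range (B' \<circ> B')"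
      using selfadj_zero [OF Q'(1)] by (auto simp: image_iff intro: exI [of _ 0])
    ultimately have "3 \<le> card (range (B' \<circ> B'))" by (metis card_mono [OF fin'])
    then show ?thesis by linarith
  next
    case False
    \<comment> \<open>With the adjoint of the projection on the left, \<open>B \<circ> B\<close>
      factors through \<open>B' \<circ> B'\<close>, so its rank is no larger.\<close>
    have adj: "X \<diamondop> (z + scale (v \<diamondop> z) w) = (X + scale (w \<diamondop> X) v) \<diamondop> z" for X z
      by (simp add: dot_add_left dot_add_right dot_commute [of X w] mult.commute)
    have BB: "B (B y) = (\<lambda>x. x + scale (w \<diamondop> x) v) (B' (B' (y + scale (v \<diamondop> y) w)))" for y
    proof (rule dot_eqI)
      fix z
      have "B (B y) \<diamondop> z = B y \<diamondop> B z" by (rule selfadjD [OF Q(1)])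
      also have "\<dots> = B' (y + scale (v \<diamondop> y) w) \<diamondop> B' (z + scale (v \<diamondop> z) w)" by (simp only: B_B')
      also have "\<dots> = B' (B' (y + scale (v \<diamondop> y) w)) \<diamondop> (z + scale (v \<diamondop> z) w)"
        by (rule selfadjD [OF Q'(1), symmetric])
      finally show "B (B y) \<diamondop> z = (\<lambda>x. x + scale (w \<diamondop> x) v) (B' (B' (y + scale (v \<diamondop> y) w))) \<diamondop> z"
        by (simp only: adj)
    qed
    have "range (B \<circ> B) \<subseteq> (\<lambda>x. x + scale (w \<diamondop> x) v) ` range (B' \<circ> B')"
    proof (rule image_subsetI)
      fix y
      have "(B' \<circ> B') (y + scale (v \<diamondop> y) w) \<in> range (B' \<circ> B')" by (rule rangeI)
      then show "(B \<circ> B) y \<in> (\<lambda>x. x + scale (w \<diamondop> x) v) ` range (B' \<circ> B')"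
        by (rule image_eqI [rotated]) (simp only: comp_apply BB)
    qed
    then have "card (range (B \<circ> B)) \<le> card (range (B' \<circ> B'))"
      using fin' by (meson card_image_le card_mono finite_imageI le_trans)
    then show ?thesis using False by simp
  qed
  then have rk: "card (range (\<lambda>x. B' x + C' x)) \<noteq> 2" by (simp add: card_range_sum_eq_square [OF q'])
  have "even k" by (rule even_rank_alternating [OF Q(1) alt c])
  then have na: "\<not> alternating B'" "\<not> alternating C'"
    using quasi_inverse_nonalternating [OF q' c'] by simp_all
  have "reaches_identity (Suc k) B'"
    using reaches_identity_of_rank [OF q' c' _ na rk] k by simp
  moreover have "v \<noteq> 0" using v(2) by auto
  ultimately show ?thesis using that v(1) q' unfolding B'_def by blast
qed

end

section \<open>Matrices as operators on finitely supported sequences\<close>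

lemma (in vectorspace) card_carrier_eq_power_dim:
  assumes fd: "fin_dim"
  shows "card (carrier V) = card (carrier K) ^ dim"
proof -
  obtain A where A: "finite A" "basis A" using finite_basis_exists [OF fd] by blast
  have AC: "A \<subseteq> carrier V" using A(2) by (simp add: basis_def)
  have ex1: "\<exists>!a. a \<in> A \<rightarrow>\<^sub>E carrier K \<and> lincomb a A = v" if "v \<in> carrier V" for v
    using basis_criterion [OF A(1) AC] A(2) that by blast
  have closed: "lincomb a A \<in> carrier V" if "a \<in> A \<rightarrow>\<^sub>E carrier K" for a
    using that AC by (intro lincomb_closed) auto
  have "bij_betw (\<lambda>a. lincomb a A) (A \<rightarrow>\<^sub>E carrier K) (carrier V)"
    unfolding bij_betw_def inj_on_def image_def using ex1 closed by blast
  then have "card (carrier V) = card (A \<rightarrow>\<^sub>E carrier K)" by (metis bij_betw_same_card)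
  also have "\<dots> = card (carrier K) ^ card A" using A(1) by (simp add: card_PiE)
  also have "card A = dim" using dim_basis A by simp
  finally show ?thesis .
qed

lemma card_bit_UNIV: "card (UNIV :: bit set) = 2"
proof -
  have "x \<in> {0, 1}" for x :: bit by (cases x) simp_all
  then have "(UNIV :: bit set) = {0, 1}" by blast
  then have "card (UNIV :: bit set) = card {0, 1 :: bit}" by (rule arg_cong)
  also have "\<dots> = 2" by simp
  finally show ?thesis .
qed

lemma card_mult_mat_vec_image:
  fixes A :: "bit mat"
  assumes A: "A \<in> carrier_mat n n"
  shows "card ((\<lambda>x. A *\<^sub>v x) ` carrier_vec n) = 2 ^ rank2 n A"
proof -
  interpret vec_space "TYPE(bit)" n .
  let ?W = "span_vs (set (cols A))"
  have sub: "set (cols A) \<subseteq> carrier_vec n" using cols_dim A by blast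
  have vs: "vectorspace class_ring ?W"
    using span_is_subspace [OF sub] by (rule subspace_is_vs)
  have "card (carrier ?W) = card (carrier (class_ring :: bit ring)) ^ vectorspace.dim class_ring ?W"
    by (rule vectorspace.card_carrier_eq_power_dim [OF vs fin_dim_span_cols [OF A]])
  moreover have "carrier ?W = (\<lambda>x. A *\<^sub>v x) ` carrier_vec n"
    using col_space_eq [OF A] A unfolding col_space_def by auto
  moreover have "carrier (class_ring :: bit ring) = UNIV" by (simp add: class_ring_simps)
  ultimately show ?thesis by (simp add: rank2_def rank_def card_bit_UNIV)
qed

lemma finite_bit_UNIV: "finite (UNIV :: bit set)"
  by (rule card_ge_0_finite) (simp only: card_bit_UNIV zero_less_numeral)

lemma card_carrier_bit_vec: "card (carrier_vec n :: bit vec set) = 2 ^ n"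
proof -
  have "bij_betw list_of_vec (carrier_vec n :: bit vec set) {xs. set xs \<subseteq> UNIV \<and> length xs = n}"
  proof (rule bij_betw_byWitness [where f' = vec_of_list])
    show "list_of_vec ` carrier_vec n \<subseteq> {xs :: bit list. set xs \<subseteq> UNIV \<and> length xs = n}"
      by (rule image_subsetI) (simp add: carrier_vecD)
    show "vec_of_list ` {xs :: bit list. set xs \<subseteq> UNIV \<and> length xs = n} \<subseteq> carrier_vec n"
      by (rule image_subsetI) (simp add: carrier_vecI)
  qed (simp_all add: vec_list list_vec)
  from bij_betw_same_card [OF this] show ?thesis
    by (simp only: card_lists_length_eq [OF finite_bit_UNIV] card_bit_UNIV)
qed

lemma finite_carrier_bit_vec: "finite (carrier_vec n :: bit vec set)"
  by (rule finite_if_card_power2 [OF card_carrier_bit_vec])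

text \<open>Vectors of all dimensions are embedded in one type, that of finitely supported bit sequences,
  for which polynomials serve as a ready-made implementation.\<close>

definition seq_dot :: "bit poly \<Rightarrow> bit poly \<Rightarrow> bit"
  where "seq_dot p q = (\<Sum>i\<le>degree p. coeff p i * coeff q i)"

lemma seq_dot_eq_sum:
  assumes "\<And>i. i \<ge> N \<Longrightarrow> coeff p i = 0"
  shows "seq_dot p q = (\<Sum>i<N. coeff p i * coeff q i)"
proof -
  have "(\<Sum>i\<le>degree p. coeff p i * coeff q i) = (\<Sum>i\<in>{..degree p} \<union> {..<N}. coeff p i * coeff q i)"
    by (rule sum.mono_neutral_left) (auto simp: coeff_eq_0)
  also have "\<dots> = (\<Sum>i<N. coeff p i * coeff q i)"
    by (rule sum.mono_neutral_right) (auto simp: assms)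
  finally show ?thesis by (simp add: seq_dot_def)
qed

lemma seq_dot_monom: "seq_dot p (monom 1 i) = coeff p i"
proof -
  let ?N = "Suc (max i (degree p))"
  have "seq_dot p (monom 1 i) = (\<Sum>j<?N. coeff p j * coeff (monom 1 i) j)"
    by (rule seq_dot_eq_sum) (auto simp: coeff_eq_0)
  also have "\<dots> = (\<Sum>j<?N. if j = i then coeff p i else 0)"
    by (rule sum.cong) auto
  finally show ?thesis by (simp add: less_Suc_eq_le)
qed

interpretation seq: binary_form seq_dot
proof
  fix x y z :: "bit poly"
  show "x + x = 0" by (rule poly_eqI) (simp only: coeff_add bit_add_self coeff_0)
  let ?N = "Suc (max (degree x) (degree y))"
  have "coeff x i = 0" "coeff y i = 0" if "i \<ge> ?N" for i
    using that by (auto intro: coeff_eq_0)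
  then have eq: "seq_dot x z = (\<Sum>i<?N. coeff x i * coeff z i)" "seq_dot y z = (\<Sum>i<?N. coeff y i * coeff z i)"
    "seq_dot (x + y) z = (\<Sum>i<?N. coeff (x + y) i * coeff z i)" for z
    by (intro seq_dot_eq_sum; simp)+
  show "seq_dot (x + y) z = seq_dot x z + seq_dot y z"
    unfolding eq by (simp add: sum.distrib algebra_simps)
  show "seq_dot x y = seq_dot y x"
    unfolding eq by (simp add: mult.commute)
next
  fix x assume "\<And>y. seq_dot x y = 0"
  then have "coeff x i = 0" for i by (metis seq_dot_monom)
  then show "x = 0" by (intro poly_eqI) simp
qed

section \<open>Embedding of vectors and matrices\<close>

definition vec_seq :: "bit vec \<Rightarrow> bit poly"
  where "vec_seq v = Poly (list_of_vec v)"

text \<open>The matrix is extended by zero beyond the first \<open>n\<close> coordinates, which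
  preserves its rank. So \<open>1\<^sub>m n\<close> becomes a projection, and the identity plus
  \<open>mat_op n (A - 1\<^sub>m n)\<close> acts as \<open>A\<close> on these coordinates and
  trivially on the others.\<close>

definition mat_op :: "nat \<Rightarrow> bit mat \<Rightarrow> bit poly \<Rightarrow> bit poly"
  where "mat_op n B p = vec_seq (B *\<^sub>v vec n (coeff p))"

lemma coeff_vec_seq: "coeff (vec_seq v) i = (if i < dim_vec v then v $ i else 0)"
  by (simp add: vec_seq_def coeff_Poly_eq nth_default_def list_of_vec_index)

lemma coeff_mat_op:
  assumes "B \<in> carrier_mat n n"
  shows "coeff (mat_op n B p) i = (if i < n then \<Sum>j<n. B $$ (i, j) * coeff p j else 0)"
  using assms by (auto simp: mat_op_def coeff_vec_seq scalar_prod_def atLeast0LessThan)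

lemma vec_coeff_vec_seq: "v \<in> carrier_vec n \<Longrightarrow> vec n (coeff (vec_seq v)) = v"
  by (rule eq_vecI) (auto simp: coeff_vec_seq)

lemma vec_seq_inj: "v \<in> carrier_vec n \<Longrightarrow> w \<in> carrier_vec n \<Longrightarrow> vec_seq v = vec_seq w \<Longrightarrow> v = w"
  by (metis vec_coeff_vec_seq)

lemma coeff_scale: "coeff (seq.scale c u) i = c * coeff u i"
  by (cases c) simp_all

definition outer_mat :: "nat \<Rightarrow> bit vec \<Rightarrow> bit mat"
  where "outer_mat n u = mat n n (\<lambda>(i, j). u $ i * u $ j)"

lemma outer_mat_carrier [simp]: "outer_mat n u \<in> carrier_mat n n"
  by (simp add: outer_mat_def)

lemma mat_op_add:
  assumes "A \<in> carrier_mat n n" "B \<in> carrier_mat n n"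
  shows "mat_op n (A + B) p = mat_op n A p + mat_op n B p"
  using assms by (intro poly_eqI) (simp add: coeff_mat_op sum.distrib algebra_simps)

lemma mat_op_diff:
  assumes "A \<in> carrier_mat n n" "B \<in> carrier_mat n n"
  shows "mat_op n (A - B) p = mat_op n A p + mat_op n B p"
  using assms
  by (intro poly_eqI) (simp add: coeff_mat_op [OF minus_carrier_mat [OF assms(2)]] coeff_mat_op sum.distrib algebra_simps)

lemma mat_op_mult:
  assumes "A \<in> carrier_mat n n" "B \<in> carrier_mat n n"
  shows "mat_op n A (mat_op n B p) = mat_op n (A * B) p"
  using assms by (simp add: mat_op_def vec_coeff_vec_seq)

lemma mat_op_outer:
  assumes "u \<in> carrier_vec n"
  shows "mat_op n (outer_mat n u) p = seq.scale (seq_dot (vec_seq u) p) (vec_seq u)"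
proof -
  have "seq_dot (vec_seq u) p = (\<Sum>j<n. u $ j * coeff p j)"
    using assms by (subst seq_dot_eq_sum [of n]) (auto simp: coeff_vec_seq)
  then show ?thesis
    using assms
    by (intro poly_eqI)
       (auto simp: coeff_mat_op coeff_scale coeff_vec_seq outer_mat_def sum_distrib_left mult_ac intro!: sum.cong)
qed

lemma mat_op_inj:
  assumes A: "A \<in> carrier_mat n n" and B: "B \<in> carrier_mat n n" and eq: "mat_op n A = mat_op n B"
  shows "A = B"
proof (rule eq_matI)
  fix i j assume ij: "i < dim_row B" "j < dim_col B"
  have *: "coeff (mat_op n M (monom 1 j)) i = M $$ (i, j)" if "M \<in> carrier_mat n n" for M
    using that ij B by (simp add: coeff_mat_op if_distrib [of "(*) _"] cong: if_cong)
  show "A $$ (i, j) = B $$ (i, j)" using * [OF A] * [OF B] eq by simp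
qed (use A B in auto)

lemma mat_op_zero_iff:
  assumes "B \<in> carrier_mat n n"
  shows "mat_op n B = (\<lambda>_. 0) \<longleftrightarrow> B = 0\<^sub>m n n"
proof -
  have "mat_op n (0\<^sub>m n n) = (\<lambda>_. 0)" by (intro ext poly_eqI) (simp add: coeff_mat_op)
  then show ?thesis using mat_op_inj [OF assms, of "0\<^sub>m n n"] by auto
qed

lemma range_mat_op:
  shows "range (mat_op n B) = vec_seq ` (\<lambda>x. B *\<^sub>v x) ` carrier_vec n"
    and "mat_op n B ` vec_seq ` carrier_vec n = range (mat_op n B)"
proof -
  have "range (mat_op n B) = vec_seq ` (\<lambda>x. B *\<^sub>v x) ` range (\<lambda>p. vec n (coeff p))"
    by (auto simp: mat_op_def)
  moreover have "range (\<lambda>p. vec n (coeff p)) = (carrier_vec n :: bit vec set)"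
    by (auto simp: image_iff) (metis vec_coeff_vec_seq)
  ultimately show 1: "range (mat_op n B) = vec_seq ` (\<lambda>x. B *\<^sub>v x) ` carrier_vec n" by simp
  have "mat_op n B ` vec_seq ` carrier_vec n = vec_seq ` (\<lambda>x. B *\<^sub>v x) ` carrier_vec n"
    unfolding image_image by (rule image_cong) (simp_all add: mat_op_def vec_coeff_vec_seq)
  then show "mat_op n B ` vec_seq ` carrier_vec n = range (mat_op n B)" using 1 by simp
qed

lemma range_mat_op_subset: "B \<in> carrier_mat n n \<Longrightarrow> range (mat_op n B) \<subseteq> vec_seq ` carrier_vec n"
  unfolding range_mat_op(1) by auto

lemma card_range_mat_op:
  assumes "B \<in> carrier_mat n n" shows "card (range (mat_op n B)) = 2 ^ rank2 n B"
proof -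
  have "inj_on vec_seq ((\<lambda>x. B *\<^sub>v x) ` carrier_vec n)"
    by (rule inj_onI, rule vec_seq_inj [of _ n]) (use assms in auto)
  then show ?thesis
    unfolding range_mat_op(1) by (simp add: card_image card_mult_mat_vec_image [OF assms])
qed

interpretation seq_sub: binary_subspace seq_dot "vec_seq ` carrier_vec n" for n
proof
  fix x y assume x: "x \<in> vec_seq ` carrier_vec n"
  then obtain v where v: "v \<in> carrier_vec n" "x = vec_seq v" by blast
  show "x + y \<in> vec_seq ` carrier_vec n" if y: "y \<in> vec_seq ` carrier_vec n"
  proof -
    obtain w where w: "w \<in> carrier_vec n" "y = vec_seq w" using y by blast
    have "x + y = vec_seq (v + w)" using v w by (intro poly_eqI) (simp add: coeff_vec_seq)
    then show ?thesis by (rule image_eqI) (simp add: v w)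
  qed
  show "x = 0" if z: "\<And>y. y \<in> vec_seq ` carrier_vec n \<Longrightarrow> seq_dot x y = 0"
  proof (rule poly_eqI)
    fix i
    show "coeff x i = coeff 0 i"
    proof (cases "i < n")
      case True
      have "vec_seq (unit_vec n i) = monom 1 i"
        using True by (intro poly_eqI) (auto simp: coeff_vec_seq)
      then have "seq_dot x (monom 1 i) = 0" using z [of "monom 1 i"] by (metis imageI unit_vec_carrier)
      then show ?thesis by (simp add: seq_dot_monom)
    qed (use v in \<open>simp add: coeff_vec_seq\<close>)
  qed
qed (simp add: finite_carrier_bit_vec)

lemma card_vec_seq_carrier: "card (vec_seq ` carrier_vec n) = 2 ^ n"
  by (metis card_carrier_bit_vec card_image inj_onI vec_seq_inj)

section \<open>Symmetric and invertible matrices as operators\<close>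

lemma Sym_carrier: "A \<in> Sym n \<Longrightarrow> A \<in> carrier_mat n n"
  by (simp add: Sym_def)

lemma Sym_index: "A \<in> Sym n \<Longrightarrow> i < n \<Longrightarrow> j < n \<Longrightarrow> A $$ (i, j) = A $$ (j, i)"
  unfolding Sym_def by (metis (mono_tags, lifting) carrier_matD index_transpose_mat(1) mem_Collect_eq)

lemma Sym_diff: "A \<in> Sym n \<Longrightarrow> B \<in> Sym n \<Longrightarrow> A - B \<in> Sym n"
  by (auto simp: Sym_def transpose_minus)

lemma Sym_one: "1\<^sub>m n \<in> Sym n"
  by (simp add: Sym_def)

lemma Sym_add_outer: "A \<in> Sym n \<Longrightarrow> A + outer_mat n u \<in> Sym n"
  by (auto simp: Sym_def transpose_add [of _ n n]) (simp add: outer_mat_def mat_eq_iff mult.commute)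

lemma selfadj_mat_op:
  assumes "B \<in> Sym n" shows "seq.selfadj (mat_op n B)"
  unfolding seq.selfadj_def
proof (intro allI)
  fix p q
  note B = Sym_carrier [OF assms]
  have eq: "seq_dot (mat_op n B p) q = (\<Sum>i<n. \<Sum>j<n. B $$ (i, j) * coeff p j * coeff q i)" for p q
    using B by (subst seq_dot_eq_sum [of n]) (auto simp: coeff_mat_op sum_distrib_right)
  have "seq_dot (mat_op n B p) q = (\<Sum>i<n. \<Sum>j<n. B $$ (i, j) * coeff q j * coeff p i)"
    unfolding eq by (subst sum.swap) (auto intro!: sum.cong simp: Sym_index [OF assms] mult_ac)
  then show "seq_dot (mat_op n B p) q = seq_dot p (mat_op n B q)"
    by (simp add: eq [symmetric] seq.dot_commute [of p])
qed

lemma mat_op_one_vec_seq: "v \<in> carrier_vec n \<Longrightarrow> mat_op n (1\<^sub>m n) (vec_seq v) = vec_seq v"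
  by (simp add: mat_op_def vec_coeff_vec_seq)

text \<open>The inverse \<open>X\<close> of a symmetric matrix is symmetric, and in
  \<open>(A - 1) * (X - 1)\<close> the two identity matrices cancel, leaving
  \<open>A + X\<close>.\<close>

lemma SGL_quasi_inverse:
  assumes "A \<in> SGL n"
  obtains C where "seq.quasi_inverse (mat_op n (A - 1\<^sub>m n)) C"
proof -
  have A: "A \<in> Sym n" "A \<in> carrier_mat n n" using assms by (auto simp: SGL_def Sym_def)
  obtain X where X: "A * X = 1\<^sub>m n" "X * A = 1\<^sub>m (dim_row X)"
    using assms A(2) unfolding SGL_def invertible_mat_def inverts_mat_def by auto
  have Xc: "X \<in> carrier_mat n n"
    using arg_cong [OF X(1), of dim_col] arg_cong [OF X(2), of dim_col] A(2) by auto
  then have XA: "X * A = 1\<^sub>m n" using X by simp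
  have "X\<^sup>T * A = 1\<^sub>m n"
    using arg_cong [OF X(1), of transpose_mat] transpose_mult [OF A(2) Xc] A(1) by (simp add: Sym_def)
  then have "X\<^sup>T = X"
    using assoc_mult_mat [of "X\<^sup>T" n n A n X n] Xc A(2) X(1) by simp
  then have XS: "X \<in> Sym n" using Xc by (simp add: Sym_def)
  have "seq.quasi_inverse (mat_op n (A - 1\<^sub>m n)) (mat_op n (X - 1\<^sub>m n))"
    unfolding seq.quasi_inverse_def
  proof (intro conjI allI)
    show "seq.selfadj (mat_op n (A - 1\<^sub>m n))" "seq.selfadj (mat_op n (X - 1\<^sub>m n))"
      using A XS by (simp_all add: selfadj_mat_op Sym_diff Sym_one)
    fix p
    have add: "mat_op n M (p + q) = mat_op n M p + mat_op n M q" if "M \<in> Sym n" for M p q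
      using seq.selfadj_add [OF selfadj_mat_op [OF that]] .
    show "mat_op n (A - 1\<^sub>m n) (mat_op n (X - 1\<^sub>m n) p) =
        mat_op n (A - 1\<^sub>m n) p + mat_op n (X - 1\<^sub>m n) p"
      using A Xc X(1)
      by (simp add: mat_op_diff add [OF A(1)] add [OF Sym_one] mat_op_mult add_ac)
  qed
  then show ?thesis using that by blast
qed

text \<open>A kernel vector \<open>v\<close> of \<open>A\<close> satisfies \<open>B v = v\<close>,
  and then \<open>C (B v) = B v + C v\<close> forces \<open>v = 0\<close>.\<close>

lemma SGL_if_quasi_inverse:
  assumes A: "A \<in> Sym n" and q: "seq.quasi_inverse (mat_op n (A - 1\<^sub>m n)) C"
  shows "A \<in> SGL n"
proof -
  note Ac = Sym_carrier [OF A]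
  have "det A \<noteq> 0"
  proof
    assume "det A = 0"
    then obtain v where v: "v \<in> carrier_vec n" "v \<noteq> 0\<^sub>v n" "A *\<^sub>v v = 0\<^sub>v n"
      using det_0_iff_vec_prod_zero_field [OF Ac] by blast
    have "mat_op n A (vec_seq v) = 0"
      using v by (intro poly_eqI) (simp add: mat_op_def vec_coeff_vec_seq coeff_vec_seq)
    then have "mat_op n (A - 1\<^sub>m n) (vec_seq v) = vec_seq v"
      using Ac v by (simp add: mat_op_diff mat_op_one_vec_seq)
    then have "vec_seq v = 0" using seq.quasi_inverseD(4) [OF q, of "vec_seq v"] by simp
    also have "0 = vec_seq (0\<^sub>v n)" by (intro poly_eqI) (simp add: coeff_vec_seq)
    finally have "v = 0\<^sub>v n" by (rule vec_seq_inj [OF v(1), rotated]) simp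
    then show False using v(2) by blast
  qed
  from det_non_zero_imp_unit [OF Ac this, where b = "()"]
  obtain X where "X \<in> carrier_mat n n" "X * A = 1\<^sub>m n" "A * X = 1\<^sub>m n"
    by (auto simp: Units_def ring_mat_def)
  then have "invertible_mat A"
    using Ac unfolding invertible_mat_def inverts_mat_def by auto
  then show ?thesis using A by (simp add: SGL_def)
qed

section \<open>Distances to the identity\<close>

text \<open>Counting edges rather than vertices allows induction on the length.\<close>

definition walk_of_length :: "'a set \<Rightarrow> ('a \<Rightarrow> 'a \<Rightarrow> bool) \<Rightarrow> nat \<Rightarrow> 'a \<Rightarrow> 'a \<Rightarrow> bool"
  where "walk_of_length V E k a b \<longleftrightarrow> (\<exists>xs. is_walk V E xs \<and> hd xs = a \<and> last xs = b \<and> length xs = Suc k)"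

lemma is_walk_Cons_Cons: "is_walk V E (x # y # zs) \<longleftrightarrow> x \<in> V \<and> E x y \<and> is_walk V E (y # zs)"
proof
  assume w: "is_walk V E (x # y # zs)"
  have "E ((y # zs) ! i) ((y # zs) ! Suc i)" if "Suc i < length (y # zs)" for i
    using w that unfolding is_walk_def by (elim conjE allE [of _ "Suc i"]) simp
  moreover have "E x y" using w unfolding is_walk_def by (elim conjE allE [of _ 0]) simp
  ultimately show "x \<in> V \<and> E x y \<and> is_walk V E (y # zs)"
    using w unfolding is_walk_def by simp
next
  assume w: "x \<in> V \<and> E x y \<and> is_walk V E (y # zs)"
  have "E ((x # y # zs) ! i) ((x # y # zs) ! Suc i)" if "Suc i < length (x # y # zs)" for i
    using w that unfolding is_walk_def by (cases i) auto
  then show "is_walk V E (x # y # zs)" using w unfolding is_walk_def by simp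
qed

lemma walk_of_length_0 [simp]: "walk_of_length V E 0 a b \<longleftrightarrow> a = b \<and> a \<in> V"
  unfolding walk_of_length_def is_walk_def by (auto simp: length_Suc_conv intro!: exI [of _ "[b]"])

lemma walk_of_length_Suc:
  "walk_of_length V E (Suc k) a b \<longleftrightarrow> a \<in> V \<and> (\<exists>c. E a c \<and> walk_of_length V E k c b)"
proof
  assume "walk_of_length V E (Suc k) a b"
  then obtain xs where xs: "is_walk V E xs" "hd xs = a" "last xs = b" "length xs = Suc (Suc k)"
    unfolding walk_of_length_def by blast
  then obtain c ys where "xs = a # c # ys" by (cases xs; cases "tl xs") auto
  then show "a \<in> V \<and> (\<exists>c. E a c \<and> walk_of_length V E k c b)"
    using xs unfolding walk_of_length_def is_walk_Cons_Cons
    by (intro conjI exI [of _ c] exI [of _ "c # ys"]) (auto simp: is_walk_Cons_Cons)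
next
  assume "a \<in> V \<and> (\<exists>c. E a c \<and> walk_of_length V E k c b)"
  then obtain c xs where a: "a \<in> V" "E a c" and xs: "is_walk V E xs" "hd xs = c" "last xs = b" "length xs = Suc k"
    unfolding walk_of_length_def by blast
  then obtain ys where "xs = c # ys" by (cases xs) auto
  then show "walk_of_length V E (Suc k) a b"
    using a xs unfolding walk_of_length_def by (intro exI [of _ "a # xs"]) (simp add: is_walk_Cons_Cons)
qed

lemma gdist_le: "walk_of_length V E k a b \<Longrightarrow> gdist V E a b \<le> enat k"
  unfolding gdist_def walk_of_length_def by (force intro: INF_lower2)

lemma gdist_eqI:
  assumes "walk_of_length V E k a b" "\<And>j. walk_of_length V E j a b \<Longrightarrow> k \<le> j"
  shows "gdist V E a b = enat k"
proof (rule antisym [OF gdist_le [OF assms(1)]])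
  show "enat k \<le> gdist V E a b"
    unfolding gdist_def
  proof (rule INF_greatest)
    fix xs assume xs: "xs \<in> {xs. is_walk V E xs \<and> hd xs = a \<and> last xs = b}"
    then have "xs \<noteq> []" by (simp add: is_walk_def)
    then have "walk_of_length V E (length xs - 1) a b"
      using xs unfolding walk_of_length_def by (intro exI [of _ xs]) simp
    then show "enat k \<le> enat (length xs - 1)" using assms(2) by simp
  qed
qed

section \<open>Edges and walks as sequences of updates\<close>

abbreviation shift_op :: "nat \<Rightarrow> bit mat \<Rightarrow> bit poly \<Rightarrow> bit poly"
  where "shift_op n A \<equiv> mat_op n (A - 1\<^sub>m n)"

lemma bit_mat_diff_self_add:
  fixes A :: "bit mat"
  assumes "A \<in> carrier_mat n n" "B \<in> carrier_mat n n"
  shows "A - (A + B) = B" "A + (A - B) = B"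
  using assms by (auto intro!: eq_matI)

lemma shift_op_add_outer:
  assumes "A \<in> carrier_mat n n" "u \<in> carrier_vec n"
  shows "shift_op n (A + outer_mat n u) = seq.upd (shift_op n A) (vec_seq u)"
  using assms by (intro ext) (simp add: mat_op_diff mat_op_add mat_op_outer seq.upd_def add_ac)

lemma selfadj_shift_op: "A \<in> Sym n \<Longrightarrow> seq.selfadj (shift_op n A)"
  by (intro selfadj_mat_op Sym_diff Sym_one)

lemma card_range_shift_op: "A \<in> Sym n \<Longrightarrow> card (range (shift_op n A)) = 2 ^ rank2 n (A - 1\<^sub>m n)"
  by (intro card_range_mat_op) (simp add: minus_carrier_mat)

lemma rank2_outer:
  assumes "u \<in> carrier_vec n" "vec_seq u \<noteq> 0" shows "rank2 n (outer_mat n u) = 1"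
proof -
  have "mat_op n (outer_mat n u) = (\<lambda>p. seq.scale (seq_dot (vec_seq u) p) (vec_seq u))"
    using assms by (intro ext) (simp add: mat_op_outer)
  then have "card (range (mat_op n (outer_mat n u))) = 2"
    using seq.card_range_rank_one [OF assms(2)] by simp
  then have "(2::nat) ^ rank2 n (outer_mat n u) = 2 ^ 1" using card_range_mat_op by simp
  then show ?thesis by (simp only: power_inject_exp)
qed

lemma radj_add_outer:
  assumes "A \<in> carrier_mat n n" "u \<in> carrier_vec n" "vec_seq u \<noteq> 0"
  shows "radj n A (A + outer_mat n u)"
  using assms by (simp add: radj_def bit_mat_diff_self_add(1) rank2_outer)

text \<open>A symmetric matrix of rank one over the binary field has the form
  \<open>u u\<^sup>T\<close>, so every edge is an update.\<close>

lemma radj_outerE: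
  assumes A: "A \<in> Sym n" and B: "B \<in> Sym n" and adj: "radj n A B"
  obtains u where "u \<in> carrier_vec n" "B = A + outer_mat n u"
proof -
  note Ac = Sym_carrier [OF A] and Bc = Sym_carrier [OF B]
  have Dc: "A - B \<in> carrier_mat n n" using Bc by (rule minus_carrier_mat)
  have "card (range (mat_op n (A - B))) = 2"
    using card_range_mat_op [OF Dc] adj by (simp add: radj_def)
  then obtain f where f: "f \<noteq> 0" "\<And>p. mat_op n (A - B) p = seq.scale (seq_dot f p) f"
    using seq.rank_one_selfadj [OF selfadj_mat_op [OF Sym_diff [OF A B]]] by blast
  obtain z where "seq_dot f z = 1" using seq.exists_dot_one f(1) by blast
  then have "f \<in> range (mat_op n (A - B))" using f(2) [of z] by (metis rangeI seq.scale_zero_one(2))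
  then obtain u where u: "u \<in> carrier_vec n" "f = vec_seq u" using range_mat_op_subset [OF Dc] by blast
  have "mat_op n (A - B) = mat_op n (outer_mat n u)"
    using f(2) u by (intro ext) (simp add: mat_op_outer)
  then have "A - B = outer_mat n u" by (rule mat_op_inj [OF Dc outer_mat_carrier])
  then have "B = A + outer_mat n u" using bit_mat_diff_self_add(2) [OF Ac Bc] by simp
  then show ?thesis using that u by blast
qed

lemma outer_sum_walk:
  assumes "seq.outer_sum k F" "F = shift_op n A" "A \<in> Sym n"
  shows "walk_of_length (Sym n) (radj n) k A (1\<^sub>m n)"
  using assms
proof (induction arbitrary: A)
  case outer_sum_0
  have Dc: "A - 1\<^sub>m n \<in> carrier_mat n n" by (simp add: minus_carrier_mat)
  have "A - 1\<^sub>m n = 0\<^sub>m n n" using mat_op_zero_iff [OF Dc] outer_sum_0 by simp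
  then have "1\<^sub>m n = A + 0\<^sub>m n n"
    using bit_mat_diff_self_add(2) [OF Sym_carrier [OF outer_sum_0(2)], of "1\<^sub>m n"] by simp
  then show ?case using outer_sum_0(2) Sym_carrier by simp
next
  case (outer_sum_Suc u B k)
  note Ac = Sym_carrier [OF outer_sum_Suc.prems(2)]
  obtain v where v: "v \<in> carrier_vec n" "u = vec_seq v"
    using outer_sum_Suc.hyps(1) outer_sum_Suc.prems(1) range_mat_op_subset [of "A - 1\<^sub>m n" n]
    by (auto simp: minus_carrier_mat)
  have "walk_of_length (Sym n) (radj n) k (A + outer_mat n v) (1\<^sub>m n)"
    using outer_sum_Suc.IH [of "A + outer_mat n v"] outer_sum_Suc.prems v Ac
    by (simp add: shift_op_add_outer Sym_add_outer)
  moreover have "radj n A (A + outer_mat n v)"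
    using radj_add_outer [OF Ac v(1)] outer_sum_Suc.hyps(2) v(2) by simp
  ultimately show ?case using outer_sum_Suc.prems(2) unfolding walk_of_length_Suc by blast
qed

lemma reaches_identity_walk:
  assumes "seq.reaches_identity k F" "F = shift_op n A" "A \<in> SGL n"
  shows "walk_of_length (SGL n) (radj n) k A (1\<^sub>m n)"
  using assms
proof (induction arbitrary: A)
  case reaches_identity_0
  then have S: "A \<in> Sym n" by (simp add: SGL_def)
  have "walk_of_length (Sym n) (radj n) 0 A (1\<^sub>m n)"
    by (rule outer_sum_walk [OF seq.outer_sum_0 reaches_identity_0(1) S])
  then show ?case using reaches_identity_0(2) by simp
next
  case (reaches_identity_Suc B u C k)
  have S: "A \<in> Sym n" using reaches_identity_Suc.prems(2) by (simp add: SGL_def)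
  note Ac = Sym_carrier [OF S]
  obtain v where v: "v \<in> carrier_vec n" "u = vec_seq v"
    using reaches_identity_Suc.hyps(2) reaches_identity_Suc.prems(1) range_mat_op_subset [of "A - 1\<^sub>m n" n]
    by (auto simp: minus_carrier_mat)
  have eq: "seq.upd B u = shift_op n (A + outer_mat n v)"
    using reaches_identity_Suc.prems(1) v Ac by (simp add: shift_op_add_outer)
  have "A + outer_mat n v \<in> SGL n"
    using SGL_if_quasi_inverse [OF Sym_add_outer [OF S]] reaches_identity_Suc.hyps(1) eq by metis
  then have "walk_of_length (SGL n) (radj n) k (A + outer_mat n v) (1\<^sub>m n)"
    using reaches_identity_Suc.IH [OF eq] by simp
  moreover have "radj n A (A + outer_mat n v)"
    using radj_add_outer [OF Ac v(1)] reaches_identity_Suc.hyps(3) v(2) by simp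
  ultimately show ?case using reaches_identity_Suc.prems(2) unfolding walk_of_length_Suc by blast
qed

text \<open>Each edge at most doubles the range, which is a single point at the identity.\<close>

lemma walk_card_range_le:
  assumes "walk_of_length (Sym n) (radj n) k A (1\<^sub>m n)"
  shows "card (range (shift_op n A)) \<le> 2 ^ k"
  using assms
proof (induction k arbitrary: A)
  case 0
  have "shift_op n (1\<^sub>m n) = (\<lambda>_. 0)"
    by (intro ext) (simp only: mat_op_diff one_carrier_mat seq.add_self)
  then show ?case using 0 by simp
next
  case (Suc k)
  then obtain A' where A: "A \<in> Sym n" "radj n A A'" "walk_of_length (Sym n) (radj n) k A' (1\<^sub>m n)"
    by (auto simp: walk_of_length_Suc)
  have A': "A' \<in> Sym n" using A(3) by (cases k) (auto simp: walk_of_length_Suc)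
  obtain u where u: "u \<in> carrier_vec n" "A' = A + outer_mat n u" using radj_outerE [OF A(1) A' A(2)] by blast
  have "shift_op n A = seq.upd (shift_op n A') (vec_seq u)"
    using u Sym_carrier [OF A(1)] by (simp add: shift_op_add_outer)
  then have "card (range (shift_op n A)) \<le> 2 * card (range (shift_op n A'))"
    using seq.card_range_upd_le finite_if_card_power2 [OF card_range_shift_op [OF A']] by metis
  then show ?case using Suc.IH [OF A(3)] by simp
qed

text \<open>A walk as short as the rank must halve the range at once. That forces \<open>u\<close>
  into the range, where an update of an alternating operator changes nothing.\<close>

lemma walk_not_alternating:
  assumes "walk_of_length (Sym n) (radj n) (Suc k) A (1\<^sub>m n)"
    and c: "card (range (shift_op n A)) = 2 ^ Suc k"
  shows "\<not> seq.alternating (shift_op n A)"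
proof
  assume alt: "seq.alternating (shift_op n A)"
  obtain A' where A: "A \<in> Sym n" "radj n A A'" "walk_of_length (Sym n) (radj n) k A' (1\<^sub>m n)"
    using assms(1) by (auto simp: walk_of_length_Suc)
  have A': "A' \<in> Sym n" using A(3) by (cases k) (auto simp: walk_of_length_Suc)
  obtain u where u: "u \<in> carrier_vec n" "A' = A + outer_mat n u" using radj_outerE [OF A(1) A' A(2)] by blast
  let ?F = "shift_op n A" and ?F' = "shift_op n A'" and ?u = "vec_seq u"
  have F': "?F' = seq.upd ?F ?u" using u Sym_carrier [OF A(1)] by (simp add: shift_op_add_outer)
  then have F: "?F = seq.upd ?F' ?u" by simp
  have fin': "finite (range ?F')" by (rule finite_if_card_power2 [OF card_range_shift_op [OF A']])
  have c': "card (range ?F') \<le> 2 ^ k" by (rule walk_card_range_le [OF A(3)])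
  have sub: "range ?F \<subseteq> range ?F' \<union> (+) ?u ` range ?F'"
    unfolding F by (rule seq.range_upd_subset)
  have "card ((+) ?u ` range ?F') \<le> 2 ^ k" using card_image_le [OF fin', of "(+) ?u"] c' by simp
  then have "card (range ?F' \<union> (+) ?u ` range ?F') \<le> 2 ^ Suc k"
    using card_Un_le [of "range ?F'" "(+) ?u ` range ?F'"] c' by simp
  \<comment> \<open>The cardinalities leave no room, so the inclusion is an equality and
    \<open>u\<close> itself lies in the range.\<close>
  then have eq: "range ?F = range ?F' \<union> (+) ?u ` range ?F'"
    using fin' c by (intro card_seteq [OF _ sub]) simp_all
  have "0 \<in> range ?F'" using seq.selfadj_zero [OF selfadj_shift_op [OF A']] by (metis rangeI)
  then have "?u + 0 \<in> range ?F" unfolding eq by (intro UnI2 imageI)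
  then obtain w where "?u = ?F w" by auto
  then have "range ?F' = range ?F"
    unfolding F' using seq.range_upd_alternating [OF selfadj_shift_op [OF A(1)] alt] by simp
  then show False using c c' by simp
qed

text \<open>The zero operator is alternating too but needs no summand, hence the guard
  \<open>m > 0\<close>.\<close>

lemma dhat_one:
  assumes A: "A \<in> Sym n"
  defines "m \<equiv> rank2 n (A - 1\<^sub>m n)"
  shows "dhat n A (1\<^sub>m n) = enat (if m > 0 \<and> seq.alternating (shift_op n A) then Suc m else m)"
proof -
  let ?F = "shift_op n A"
  note sa = selfadj_shift_op [OF A] and c = card_range_shift_op [OF A, folded m_def]
  have ge: "m \<le> j" if "walk_of_length (Sym n) (radj n) j A (1\<^sub>m n)" for j
  proof -
    have "(2::nat) ^ m \<le> 2 ^ j" using walk_card_range_le [OF that] c by simp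
    then show ?thesis by (rule power_le_imp_le_exp [rotated]) simp
  qed
  show ?thesis
  proof (cases "m > 0 \<and> seq.alternating ?F")
    case True
    have "gdist (Sym n) (radj n) A (1\<^sub>m n) = enat (Suc m)"
    proof (rule gdist_eqI)
      show "walk_of_length (Sym n) (radj n) (Suc m) A (1\<^sub>m n)"
        using outer_sum_walk [OF seq.outer_sum_alternating [OF sa _ c] refl A] True by simp
      fix j assume j: "walk_of_length (Sym n) (radj n) j A (1\<^sub>m n)"
      have "j \<noteq> m"
      proof
        assume "j = m"
        moreover obtain k where "m = Suc k" using True by (cases m) auto
        ultimately show False using walk_not_alternating [of n k A] j c True by simp
      qed
      then show "Suc m \<le> j" using ge [OF j] by simp
    qed
    then show ?thesis using True by (simp add: dhat_def)
  next
    case False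
    have "seq.outer_sum m ?F"
    proof (cases "m = 0")
      case True
      then have "?F = (\<lambda>_. 0)" using seq.card_range_1 [OF sa] c by simp
      then show ?thesis using True seq.outer_sum_0 by simp
    next
      case False
      then show ?thesis
        using \<open>\<not> (m > 0 \<and> seq.alternating ?F)\<close> seq.outer_sum_nonalternating [OF sa _ c] by simp
    qed
    then have "walk_of_length (Sym n) (radj n) m A (1\<^sub>m n)" by (rule outer_sum_walk [OF _ refl A])
    then have "gdist (Sym n) (radj n) A (1\<^sub>m n) = enat m" using ge by (rule gdist_eqI)
    then show ?thesis using False by (simp only: dhat_def if_False)
  qed
qed

section \<open>Upper bounds in the invertible graph\<close>

lemma dG_large_odd_rank:
  assumes A: "A \<in> SGL n" and r: "rank2 n (A - 1\<^sub>m n) = k" and "odd k" "n + 3 \<le> 2 * k"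
  shows "dG n A (1\<^sub>m n) \<le> enat k"
proof -
  have S: "A \<in> Sym n" using A by (simp add: SGL_def)
  obtain C where q: "seq.quasi_inverse (shift_op n A) C" using SGL_quasi_inverse [OF A] by blast
  have "seq.reaches_identity k (shift_op n A)"
    by (rule seq_sub.reaches_identity_large_odd_rank [OF q range_mat_op(2) range_mat_op_subset card_vec_seq_carrier])
       (use assms card_range_shift_op [OF S] in \<open>simp_all add: minus_carrier_mat\<close>)
  then show ?thesis unfolding dG_def by (intro gdist_le reaches_identity_walk [OF _ refl A])
qed

text \<open>One preliminary edge raises the rank to \<open>k + 1\<close>, and the descent takes
  \<open>k + 1\<close> more.\<close>

lemma dG_alternating:
  assumes A: "A \<in> SGL n" and alt: "seq.alternating (shift_op n A)"
    and r: "rank2 n (A - 1\<^sub>m n) = k" and k: "k \<ge> 2" and n: "n = 2 * k + 1"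
  shows "dG n A (1\<^sub>m n) \<le> enat (k + 2)"
proof -
  have S: "A \<in> Sym n" using A by (simp add: SGL_def)
  note Ac = Sym_carrier [OF S]
  obtain C where q: "seq.quasi_inverse (shift_op n A) C" using SGL_quasi_inverse [OF A] by blast
  \<comment> \<open>Only the vector with all \<open>n\<close> entries one can represent
    \<open>y \<diamondop> y\<close>, and its product with itself is \<open>n\<close> modulo two,
    hence one.\<close>
  have char: "\<exists>y\<in>vec_seq ` carrier_vec n. seq_dot y y \<noteq> seq_dot w y"
    if w: "w \<in> vec_seq ` carrier_vec n" "seq_dot w w = 0" for w
  proof (rule ccontr)
    assume no: "\<not> ?thesis"
    have "coeff w i = 1" if i: "i < n" for i
    proof -
      have "vec_seq (unit_vec n i) = monom 1 i"
        using i by (intro poly_eqI) (auto simp: coeff_vec_seq)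
      then have "monom 1 i \<in> vec_seq ` carrier_vec n" by (metis imageI unit_vec_carrier)
      then have "seq_dot (monom 1 i) (monom 1 i) = seq_dot w (monom 1 i)" using no by blast
      then show ?thesis by (simp add: seq_dot_monom)
    qed
    moreover have "seq_dot w w = (\<Sum>i<n. coeff w i * coeff w i)"
      using w(1) by (intro seq_dot_eq_sum) (auto simp: coeff_vec_seq)
    ultimately have "seq_dot w w = of_nat n" by simp
    then show False using w(2) n by simp
  qed
  obtain v C' where v: "v \<in> vec_seq ` carrier_vec n" "v \<noteq> 0"
    "seq.quasi_inverse (seq.upd (shift_op n A) v) C'"
    "seq.reaches_identity (Suc k) (seq.upd (shift_op n A) v)"
    by (rule seq_sub.alternating_step [OF q alt range_mat_op(2) range_mat_op_subset _ _ k char])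
       (use card_range_shift_op [OF S] r n in \<open>simp_all add: minus_carrier_mat card_vec_seq_carrier\<close>)
  obtain u where u: "u \<in> carrier_vec n" "v = vec_seq u" using v(1) by blast
  have eq: "seq.upd (shift_op n A) v = shift_op n (A + outer_mat n u)"
    using u Ac by (simp add: shift_op_add_outer)
  have "A + outer_mat n u \<in> SGL n"
    using SGL_if_quasi_inverse [OF Sym_add_outer [OF S]] v(3) eq by metis
  then have "walk_of_length (SGL n) (radj n) (Suc k) (A + outer_mat n u) (1\<^sub>m n)"
    by (rule reaches_identity_walk [OF v(4) eq])
  moreover have "radj n A (A + outer_mat n u)"
    using radj_add_outer [OF Ac u(1)] v(2) u(2) by simp
  ultimately have "walk_of_length (SGL n) (radj n) (Suc (Suc k)) A (1\<^sub>m n)"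
    using A unfolding walk_of_length_Suc [of _ _ "Suc k"] by blast
  then show ?thesis unfolding dG_def using gdist_le by fastforce
qed

theorem theorem8p5:
  fixes n :: nat
  assumes "odd n" and "n \<ge> 3"
  shows "(odd ((n + 1) div 2) \<longrightarrow>
           SD n = {A \<in> SGL n. dG n A (1\<^sub>m n) = enat ((n + 5) div 2) \<and>
                              dhat n A (1\<^sub>m n) = enat ((n + 1) div 2)})
       \<and> (even ((n + 1) div 2) \<longrightarrow>
           SD n = {A \<in> SGL n. dG n A (1\<^sub>m n) = enat ((n + 5) div 2) \<and>
                              dhat n A (1\<^sub>m n) \<in> {enat ((n + 1) div 2), enat ((n + 3) div 2)}})"
proof -
  define r where "r = (n + 1) div 2"
  have n: "n = 2 * r - 1" and r: "r \<ge> 2" and halves: "(n + 5) div 2 = r + 2" "(n + 3) div 2 = r + 1"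
    using assms unfolding r_def by (auto elim!: oddE)
  have main: "rank2 n (A - 1\<^sub>m n) = r \<longleftrightarrow>
      (if odd r then dhat n A (1\<^sub>m n) = enat r else dhat n A (1\<^sub>m n) \<in> {enat r, enat (r + 1)})"
    if A: "A \<in> SGL n" and d: "dG n A (1\<^sub>m n) = enat (r + 2)" for A
  proof -
    define m where "m = rank2 n (A - 1\<^sub>m n)"
    have S: "A \<in> Sym n" using A by (simp add: SGL_def)
    have dh: "dhat n A (1\<^sub>m n) = enat (if m > 0 \<and> seq.alternating (shift_op n A) then Suc m else m)"
      using dhat_one [OF S] by (simp add: m_def)
    have par: "even m" if "seq.alternating (shift_op n A)"
      using seq.even_rank_alternating [OF selfadj_shift_op [OF S] that] card_range_shift_op [OF S]
      by (simp add: m_def)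
    \<comment> \<open>Such a rank is odd and meets the bound \<open>n + 3 \<le> 2 * m\<close> with
      equality, so the identity would be reached in \<open>r + 1\<close> steps.\<close>
    have large: "\<not> (even r \<and> m = r + 1)"
    proof
      assume *: "even r \<and> m = r + 1"
      then have "dG n A (1\<^sub>m n) \<le> enat m"
        by (intro dG_large_odd_rank [OF A]) (use n r in \<open>auto simp: m_def\<close>)
      then show False using d * by simp
    qed
    \<comment> \<open>Odd \<open>r\<close> is at least three, so \<open>m \<ge> 2\<close> and
      \<open>n = 2 * m + 1\<close>; the distance would be at most
      \<open>m + 2 = r + 1\<close>.\<close>
    have alt: "\<not> (odd r \<and> Suc m = r \<and> seq.alternating (shift_op n A))"
    proof
      assume *: "odd r \<and> Suc m = r \<and> seq.alternating (shift_op n A)"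
      then have "m \<ge> 2" using r by (cases "r = 2") auto
      then have "dG n A (1\<^sub>m n) \<le> enat (m + 2)"
        using * n by (intro dG_alternating [OF A]) (auto simp: m_def)
      then show False using d * by auto
    qed
    \<comment> \<open>For odd \<open>r\<close>, \<open>par\<close> excludes an alternating operator
      of rank \<open>r\<close> and \<open>alt\<close> one of rank \<open>r - 1\<close>. For even
      \<open>r\<close>, \<open>par\<close> excludes the latter and \<open>large\<close> the rank
      \<open>r + 1\<close>.\<close>
    show ?thesis
      unfolding m_def [symmetric] dh using par large alt r by auto
  qed
  show ?thesis
    unfolding SD_def halves r_def [symmetric]
  proof (intro conjI impI Collect_cong)
    fix A
    show "A \<in> SGL n \<and> dG n A (1\<^sub>m n) = enat (r + 2) \<and> rank2 n (A - 1\<^sub>m n) = r \<longleftrightarrow>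
        A \<in> SGL n \<and> dG n A (1\<^sub>m n) = enat (r + 2) \<and> dhat n A (1\<^sub>m n) = enat r" if "odd r"
      using main [of A] that by metis
    show "A \<in> SGL n \<and> dG n A (1\<^sub>m n) = enat (r + 2) \<and> rank2 n (A - 1\<^sub>m n) = r \<longleftrightarrow>
        A \<in> SGL n \<and> dG n A (1\<^sub>m n) = enat (r + 2) \<and> dhat n A (1\<^sub>m n) \<in> {enat r, enat (r + 1)}"
      if "even r"
      using main [of A] that by metis
  qed
qed

end
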